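(* For every $k\in\mathbb{N}$ and all positive integers $\ell_1,\ldots,\ell_k$, there exists $n_0$ such that the following holds: if $n\geq n_0$ and $\sigma$ is the layered permutation with layers of sizes $(n,1,\ell_1,\dots,\ell_k)$, then for every near-$\sigma$-optimal sequence $(\pi_m)_{m\in\mathbb{N}}$ of layered permutations, the number of layers of $\pi_m$ tends to infinity as $m\to\infty$.
   Context: A permutation of order $n$ is a bijection $\pi:[n]\to[n]$. For $m$ points $i_1<\cdots<i_m$ of $[n]$, the permutation they induce is the unique $\tau:[m]\to[m]$ with $\tau(j)<\tau(j')$ iff $\pi(i_j)<\pi(i_{j'})$. The density $d(\sigma,\pi)$ of $\sigma$ in $\pi$ (with $|\pi|\ge|\sigma|$) is the probability that $|\sigma|$ uniformly random distinct points of $[|\pi|]$ induce $\sigma$. A permutation $\sigma$ of order $m$ is layered if $[m]$ can be partitioned into consecutive intervals $I_1,\ldots,I_k$ (in order) such that $\sigma$ is decreasing on each $I_j$ and $\sigma(x)<\sigma(x')$ whenever $x\in I_j$, $x'\in I_{j'}$, $j<j'$; the $I_j$ are its layers, and $\sigma$ is called the layered permutation with layers of sizes $(|I_1|,\ldots,|I_k|)$. The packing density of $\sigma$ is $\lim_{n\to\infty}\max\{d(\sigma,\pi): |\pi|=n\}$. A sequence $(\pi_m)_{m\in\mathbb{N}}$ of permutations is near-$\sigma$-optimal if $|\pi_m|\to\infty$ and $d(\sigma,\pi_m)$ converges to the packing density of $\sigma$. *)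

theory Defs
  imports "HOL-Analysis.Analysis" "HOL-Combinatorics.Permutations"
begin

text \<open>
  A permutation of order \<open>n\<close> is a function \<open>p\<close> with \<open>p permutes {1..n}\<close>, i.e. a bijection of
  \<open>{1..n}\<close> extended by the identity. The function does not determine its order, so the order is
  carried along as a separate argument.
\<close>

text \<open>The \<open>j\<close>-th smallest element of a finite set, counting from \<open>1\<close>.\<close>
definition nth_point :: "nat set \<Rightarrow> nat \<Rightarrow> nat" where
  "nth_point A j = sorted_list_of_set A ! (j - 1)"

text \<open>For finite \<open>A\<close> on which \<open>\<pi>\<close> is injective there is exactly one such \<open>\<tau>\<close>.\<close>
definition induces :: "(nat \<Rightarrow> nat) \<Rightarrow> nat set \<Rightarrow> (nat \<Rightarrow> nat) \<Rightarrow> bool" where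
  "induces \<pi> A \<tau> \<longleftrightarrow> \<tau> permutes {1..card A} \<and>
     (\<forall>j\<in>{1..card A}. \<forall>j'\<in>{1..card A}.
        \<tau> j < \<tau> j' \<longleftrightarrow> \<pi> (nth_point A j) < \<pi> (nth_point A j'))"

text \<open>
  The density of \<open>\<sigma>\<close> (of order \<open>s\<close>) in \<open>\<pi>\<close> (of order \<open>n\<close>), as a probability in the uniform space
  of \<open>s\<close>-element subsets of \<open>{1..n}\<close>. It is only meaningful for \<open>s \<le> n\<close>; otherwise it is
  \<open>0 / 0 = 0\<close>.
\<close>
definition density :: "nat \<Rightarrow> (nat \<Rightarrow> nat) \<Rightarrow> nat \<Rightarrow> (nat \<Rightarrow> nat) \<Rightarrow> real" where
  "density s \<sigma> n \<pi> =
     real (card {A. A \<subseteq> {1..n} \<and> card A = s \<and> induces \<pi> A \<sigma>}) /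
     real (card {A. A \<subseteq> {1..n} \<and> card A = s})"

definition packing_density :: "nat \<Rightarrow> (nat \<Rightarrow> nat) \<Rightarrow> real" where
  "packing_density s \<sigma> = lim (\<lambda>n. Max {density s \<sigma> n \<pi> |\<pi>. \<pi> permutes {1..n}})"

text \<open>
  The consecutive intervals of sizes \<open>bs ! 0, bs ! 1, \<dots>\<close>, starting at \<open>1\<close>; the index \<open>j\<close>
  counts from \<open>0\<close>.
\<close>
definition layer :: "nat list \<Rightarrow> nat \<Rightarrow> nat set" where
  "layer bs j = {sum_list (take j bs) + 1 .. sum_list (take (Suc j) bs)}"

text \<open>\<open>\<sigma>\<close> is the layered permutation of order \<open>m\<close> with (nonempty) layers of sizes \<open>bs\<close>.\<close>
definition has_layers :: "nat \<Rightarrow> (nat \<Rightarrow> nat) \<Rightarrow> nat list \<Rightarrow> bool" where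
  "has_layers m \<sigma> bs \<longleftrightarrow> \<sigma> permutes {1..m} \<and> sum_list bs = m \<and> (\<forall>b\<in>set bs. 0 < b) \<and>
     (\<forall>j<length bs. \<forall>x\<in>layer bs j. \<forall>x'\<in>layer bs j. x < x' \<longrightarrow> \<sigma> x > \<sigma> x') \<and>
     (\<forall>j<length bs. \<forall>j'<length bs. j < j' \<longrightarrow>
        (\<forall>x\<in>layer bs j. \<forall>x'\<in>layer bs j'. \<sigma> x < \<sigma> x'))"

definition layered :: "nat \<Rightarrow> (nat \<Rightarrow> nat) \<Rightarrow> bool" where
  "layered m \<sigma> \<longleftrightarrow> (\<exists>bs. has_layers m \<sigma> bs)"

definition num_layers :: "nat \<Rightarrow> (nat \<Rightarrow> nat) \<Rightarrow> nat" where
  "num_layers m \<sigma> = length (THE bs. has_layers m \<sigma> bs)"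

text \<open>\<open>N m\<close> is the order of the \<open>m\<close>-th permutation \<open>\<pi> m\<close> of the sequence.\<close>
definition near_optimal ::
    "nat \<Rightarrow> (nat \<Rightarrow> nat) \<Rightarrow> (nat \<Rightarrow> nat) \<Rightarrow> (nat \<Rightarrow> nat \<Rightarrow> nat) \<Rightarrow> bool" where
  "near_optimal s \<sigma> N \<pi> \<longleftrightarrow>
     (\<forall>m. \<pi> m permutes {1..N m}) \<and>
     filterlim N at_top sequentially \<and>
     (\<lambda>m. density s \<sigma> (N m) (\<pi> m)) \<longlonglongrightarrow> packing_density s \<sigma>"

text \<open>The layers of a layered permutation are determined by it, so \<open>num_layers\<close> is well defined.\<close>

lemma layersD_dec:
  assumes "has_layers m \<sigma> bs" "j < length bs" "x \<in> layer bs j" "x' \<in> layer bs j" "x < x'"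
  shows "\<sigma> x > \<sigma> x'"
  using assms unfolding has_layers_def by (elim conjE) simp

lemma layersD_inc:
  assumes "has_layers m \<sigma> bs" "j < length bs" "j' < length bs" "j < j'"
    "x \<in> layer bs j" "x' \<in> layer bs j'"
  shows "\<sigma> x < \<sigma> x'"
  using assms unfolding has_layers_def by blast

lemma has_layersD:
  assumes "has_layers m \<sigma> bs"
  shows "sum_list bs = m" "b \<in> set bs \<Longrightarrow> 0 < b"
  using assms unfolding has_layers_def by (elim conjE, simp)+

lemma has_layers_common_prefix:
  assumes h: "has_layers m \<sigma> (ps @ b # bs)" and h': "has_layers m \<sigma> (ps @ c # cs)"
  shows "c \<le> b"
proof (rule ccontr)
  assume "\<not> c \<le> b"
  hence bc: "b < c" by simp
  define x where "x = sum_list ps + b"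
  have sums: "sum_list ps + b + sum_list bs = sum_list ps + c + sum_list cs"
    using has_layersD(1)[OF h] has_layersD(1)[OF h'] by simp
  with bc obtain d ds where ds: "bs = d # ds"
    by (cases bs) auto
  have pos: "0 < b" "0 < d"
    using has_layersD(2)[OF h] ds by simp_all
  have "x \<in> layer (ps @ b # bs) (length ps)" "x + 1 \<in> layer (ps @ b # bs) (Suc (length ps))"
    using pos ds by (auto simp: layer_def x_def)
  hence 1: "\<sigma> x < \<sigma> (x + 1)"
    using layersD_inc[OF h, of "length ps" "Suc (length ps)" x "x + 1"] ds by simp
  have "x \<in> layer (ps @ c # cs) (length ps)" "x + 1 \<in> layer (ps @ c # cs) (length ps)"
    using pos bc by (auto simp: layer_def x_def)
  hence 2: "\<sigma> x > \<sigma> (x + 1)"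
    using layersD_dec[OF h', of "length ps" x "x + 1"] by simp
  from 1 2 show False by simp
qed

lemma has_layers_unique:
  assumes "has_layers m \<sigma> bs" "has_layers m \<sigma> cs"
  shows "bs = cs"
proof -
  have "bs' = cs'" if "has_layers m \<sigma> (ps @ bs')" "has_layers m \<sigma> (ps @ cs')" for ps bs' cs'
    using that
  proof (induction bs' arbitrary: cs' ps)
    case Nil
    show ?case
    proof (cases cs')
      case (Cons c cs'')
      thus ?thesis
        using has_layersD(1)[OF Nil(1)] has_layersD(1)[OF Nil(2)] has_layersD(2)[OF Nil(2), of c]
        by simp
    qed simp
  next
    case (Cons b bs')
    then obtain c cs'' where c: "cs' = c # cs''"
      using has_layersD(1)[OF Cons.prems(1)] has_layersD(1)[OF Cons.prems(2)]
        has_layersD(2)[OF Cons.prems(1), of b]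
      by (cases cs') simp_all
    hence "b = c"
      using has_layers_common_prefix[of m \<sigma> ps b bs' c cs'']
        has_layers_common_prefix[of m \<sigma> ps c cs'' b bs'] Cons.prems by simp
    thus ?case
      using Cons.IH[of "ps @ [b]" cs''] Cons.prems c by simp
  qed
  from this[of "[]"] assms show ?thesis by simp
qed

lemma num_layers_eq:
  assumes "has_layers m \<sigma> bs"
  shows "num_layers m \<sigma> = length bs"
proof -
  have "(THE bs. has_layers m \<sigma> bs) = bs"
    by (rule the_equality[where P = "has_layers m \<sigma>"], rule assms, erule has_layers_unique, rule assms)
  thus ?thesis unfolding num_layers_def by (rule arg_cong)
qed

end

theory Submission
  imports Defs
begin

text \<open>
  Up to a constant, the density of the pattern with layers \<open>(n, 1, l\<^sub>1, \<dots>, l\<^sub>k)\<close> in a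
  large layered permutation whose layers have relative sizes \<open>x\<^sub>1, \<dots>, x\<^sub>L\<close> is a polynomial
  in the \<open>x\<^sub>i\<close>. On weight vectors of bounded length it attains its maximum by compactness, so
  it suffices that for large \<open>n\<close> every finite weight vector can be strictly improved.

  If the value is at most \<open>(3/4) ^ (n - 1)\<close>, then one layer of size \<open>7/8\<close> followed by
  \<open>k + 1\<close> equal ones is better. Otherwise some layer \<open>M\<close> exceeds \<open>3/4\<close>. If it is not
  the first one, then merging all earlier layers into it is an improvement. If it is, then the next
  layer \<open>w\<close> plays almost only the role of the singleton layer of the pattern, in which it
  contributes linearly; splitting \<open>w\<close> in half costs at most \<open>w ^ n\<close> and gains
  \<open>M ^ n * (w / 2) ^ (l\<^sub>1 + 1)\<close>, up to a common factor. For \<open>k = 0\<close> the last layer is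
  split instead.
\<close>

section \<open>Improving a weight vector\<close>

text \<open>The sum of \<open>\<Prod>\<^sub>j p (xs ! i\<^sub>j) (es ! j)\<close> over all \<open>i\<^sub>0 < i\<^sub>1 < \<dots>\<close>. With binomial
  coefficients for \<open>p\<close> it counts the copies of a layered pattern in a layered permutation, with
  powers it is, up to a constant, the limiting density.\<close>
fun layer_sum :: "('a \<Rightarrow> nat \<Rightarrow> 'b::comm_semiring_1) \<Rightarrow> nat list \<Rightarrow> 'a list \<Rightarrow> 'b" where
  "layer_sum p [] xs = 1"
| "layer_sum p (e # es) [] = 0"
| "layer_sum p (e # es) (x # xs) = p x e * layer_sum p es xs + layer_sum p (e # es) xs"

abbreviation layer_poly :: "nat list \<Rightarrow> real list \<Rightarrow> real" where
  "layer_poly \<equiv> layer_sum power"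

definition weights :: "real list \<Rightarrow> bool" where
  "weights xs \<longleftrightarrow> (\<forall>x\<in>set xs. 0 \<le> x) \<and> sum_list xs = 1"

section \<open>Bounds on the density polynomial\<close>

lemma layer_poly_nonneg: "\<forall>x\<in>set xs. 0 \<le> x \<Longrightarrow> 0 \<le> layer_poly es xs"
  by (induction "power :: real \<Rightarrow> nat \<Rightarrow> real" es xs rule: layer_sum.induct) auto

lemma layer_poly_Cons_mono:
  assumes "\<forall>y\<in>set (x # xs). 0 \<le> y"
  shows "layer_poly es xs \<le> layer_poly es (x # xs)"
  using assms layer_poly_nonneg[of xs] by (cases es) auto

lemma power_add_superadditive:
  fixes x y :: real
  assumes "0 \<le> x" "0 \<le> y" "0 < e"
  shows "x ^ e + y ^ e \<le> (x + y) ^ e"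
proof -
  obtain f where e: "e = Suc f" using \<open>0 < e\<close> by (cases e) auto
  have "x * x ^ f \<le> x * (x + y) ^ f" "y * y ^ f \<le> y * (x + y) ^ f"
    using assms by (auto intro!: mult_left_mono power_mono)
  thus ?thesis by (simp add: e algebra_simps)
qed

text \<open>The \<open>e\<close>-th power of an entry multiplies a value of \<open>es\<close> on a
  suffix, which is at most the value on the whole list, and the \<open>e\<close>-th powers of the
  entries add up to at most the power of their sum.\<close>

lemma layer_poly_Cons_le:
  assumes "\<forall>x\<in>set xs. 0 \<le> x" "0 < e"
  shows "layer_poly (e # es) xs \<le> sum_list xs ^ e * layer_poly es xs"
  using assms(1)
proof (induction xs)
  case (Cons x xs)
  let ?S = "sum_list xs"
  have nn: "0 \<le> x" "0 \<le> ?S" "0 \<le> layer_poly es xs"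
    using Cons.prems by (auto intro!: sum_list_nonneg layer_poly_nonneg)
  have "layer_poly (e # es) (x # xs) \<le> x ^ e * layer_poly es xs + ?S ^ e * layer_poly es xs"
    using Cons by simp
  also have "\<dots> = (x ^ e + ?S ^ e) * layer_poly es xs" by (simp add: algebra_simps)
  also have "\<dots> \<le> (x + ?S) ^ e * layer_poly es (x # xs)"
    using power_add_superadditive[OF nn(1,2) assms(2)] layer_poly_Cons_mono[OF Cons.prems] nn
    by (intro mult_mono) auto
  finally show ?case by simp
qed (simp add: layer_poly_nonneg)

lemma layer_poly_Cons_le_tail:
  assumes "\<forall>x\<in>set xs. 0 \<le> x" "sum_list xs \<le> 1" "0 < e"
  shows "layer_poly (e # es) xs \<le> layer_poly es xs"
proof -
  have "sum_list xs ^ e \<le> 1" using assms by (intro power_le_one sum_list_nonneg) auto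
  hence "sum_list xs ^ e * layer_poly es xs \<le> 1 * layer_poly es xs"
    using layer_poly_nonneg[OF assms(1)] by (rule mult_right_mono)
  thus ?thesis using layer_poly_Cons_le[OF assms(1,3), of es] by simp
qed

lemma layer_poly_le_1:
  assumes "\<forall>x\<in>set xs. 0 \<le> x" "sum_list xs \<le> 1" "\<forall>e\<in>set es. 0 < e"
  shows "layer_poly es xs \<le> 1"
  using assms(3)
proof (induction es)
  case (Cons e es)
  thus ?case using layer_poly_Cons_le_tail[OF assms(1,2), of e es] by simp
qed simp

text \<open>Needed in both instances: powers vanish at weight zero, binomial coefficients at an
  empty layer.\<close>

lemma layer_sum_filter:
  assumes "\<And>x e. \<not> P x \<Longrightarrow> 0 < e \<Longrightarrow> p x e = 0" "\<forall>e\<in>set es. 0 < e"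
  shows "layer_sum p es (filter P xs) = layer_sum p es xs"
  using assms(2)
proof (induction xs arbitrary: es)
  case (Cons x xs)
  thus ?case using assms(1)[of x] by (cases es) auto
qed simp

text \<open>Sort the terms by whether the factor with exponent \<open>e\<close> comes from
  \<open>pre\<close>. If it does, the other factors contribute at most \<open>1\<close>, and
  superadditivity collects the \<open>e\<close>-th powers.\<close>

lemma layer_poly_append_le:
  assumes "\<forall>x\<in>set (pre @ xs). 0 \<le> x" "sum_list (pre @ xs) \<le> 1" "\<forall>e\<in>set (e # es). 0 < e"
  shows "layer_poly (e # es) (pre @ xs) \<le> sum_list pre ^ e + layer_poly (e # es) xs"
  using assms(1,2)
proof (induction pre)
  case (Cons x pre)
  have nn: "0 \<le> x" "0 \<le> sum_list pre" "\<forall>x\<in>set (pre @ xs). 0 \<le> x" "sum_list (pre @ xs) \<le> 1"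
    using Cons.prems by (auto intro!: sum_list_nonneg)
  have "x ^ e * layer_poly es (pre @ xs) \<le> x ^ e * 1"
    using layer_poly_le_1[OF nn(3,4), of es] assms(3) nn by (intro mult_left_mono) auto
  hence "layer_poly (e # es) ((x # pre) @ xs)
      \<le> x ^ e + sum_list pre ^ e + layer_poly (e # es) xs"
    using Cons.IH[OF nn(3,4)] by simp
  also have "\<dots> \<le> (x + sum_list pre) ^ e + layer_poly (e # es) xs"
    using power_add_superadditive[OF nn(1,2), of e] assms(3) by simp
  finally show ?case by simp
qed (use assms in auto)

text \<open>One factor of \<open>x ^ Suc e\<close> is kept to be summed, the others are bounded by
  \<open>M\<close>. With total weight \<open>1\<close>, a large value therefore forces a large
  entry.\<close>

lemma layer_poly_le_Max:
  assumes "\<forall>x\<in>set xs. 0 \<le> x \<and> x \<le> M" "sum_list xs \<le> 1" "\<forall>e\<in>set es. 0 < e"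
  shows "layer_poly (Suc e # es) xs \<le> M ^ e * sum_list xs"
  using assms(1,2)
proof (induction xs)
  case (Cons x xs)
  have nn: "0 \<le> x" "x \<le> M" "\<forall>x\<in>set xs. 0 \<le> x" "sum_list xs \<le> 1"
    using Cons.prems by auto
  have "x ^ Suc e * layer_poly es xs \<le> x ^ Suc e * 1"
    using layer_poly_le_1[OF nn(3,4) assms(3)] nn by (intro mult_left_mono) auto
  also have "\<dots> \<le> M ^ e * x"
    using nn power_mono[of x M e] by (simp add: mult.commute mult_left_mono)
  finally show ?case using Cons.IH Cons.prems nn by (simp add: algebra_simps)
qed simp

text \<open>The bound is the single term that uses the first \<open>length es\<close>
  entries.\<close>

lemma layer_poly_replicate:
  assumes "0 \<le> t" "length es \<le> m"
  shows "t ^ sum_list es \<le> layer_poly es (replicate m t)"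
  using assms(2)
proof (induction es arbitrary: m)
  case (Cons e es)
  then obtain m' where m: "m = Suc m'" by (cases m) auto
  have "t ^ e * t ^ sum_list es \<le> t ^ e * layer_poly es (replicate m' t)"
    using Cons m \<open>0 \<le> t\<close> by (intro mult_left_mono) auto
  moreover have "0 \<le> layer_poly (e # es) (replicate m' t)"
    using \<open>0 \<le> t\<close> by (intro layer_poly_nonneg) auto
  ultimately show ?case by (simp add: m power_add)
qed simp

section \<open>The improving moves\<close>

lemma improve_small:
  assumes "\<forall>l\<in>set ls. 0 < l"
  shows "\<forall>\<^sub>F n in sequentially. \<exists>ys. weights ys \<and> (3/4) ^ (n - 1) < layer_poly (n # 1 # ls) ys"
proof -
  \<comment> \<open>With this value the \<open>length ls + 1\<close> small entries add up to
    \<open>1/8\<close>, which together with \<open>7/8\<close> gives total weight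
    \<open>1\<close>.\<close>
  define t :: real where "t = 1 / (8 * (real (length ls) + 1))"
  define c where "c = t ^ sum_list (1 # ls)"
  have t: "0 < t" unfolding t_def by (simp add: field_simps)
  hence c: "0 < c" unfolding c_def by simp
  \<comment> \<open>\<open>6/7\<close> is \<open>3/4\<close> divided by \<open>7/8\<close>. The
    factor \<open>3/4\<close> below makes up for the exponent \<open>n - 1\<close>, and
    \<open>c\<close> for the small entries.\<close>
  have "(\<lambda>n. (6/7 :: real) ^ n) \<longlonglongrightarrow> 0" by (rule LIMSEQ_power_zero) simp
  hence "\<forall>\<^sub>F n in sequentially. (6/7 :: real) ^ n < 3/4 * c"
    by (rule order_tendstoD(2)) (use c in simp)
  thus ?thesis using eventually_gt_at_top[of 0]
  proof eventually_elim
    case (elim n)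
    let ?ys = "7/8 # replicate (Suc (length ls)) t"
    have "weights ?ys" using t unfolding weights_def
      by (auto simp: sum_list_replicate t_def field_simps)
    moreover have "(3/4) ^ (n - 1) < layer_poly (n # 1 # ls) ?ys"
    proof -
      have "(3/4 :: real) ^ (n - 1) = 4/3 * ((7/8) ^ n * (6/7) ^ n)"
        using elim(2) by (cases n) (simp_all flip: power_mult_distrib)
      also have "\<dots> < 4/3 * ((7/8) ^ n * (3/4 * c))"
        using elim(1) by simp
      also have "\<dots> = (7/8) ^ n * c" by simp
      also have "\<dots> \<le> (7/8) ^ n * layer_poly (1 # ls) (replicate (Suc (length ls)) t)"
        unfolding c_def using t by (intro mult_left_mono layer_poly_replicate) auto
      also have "\<dots> \<le> layer_poly (n # 1 # ls) ?ys"
        using layer_poly_nonneg[of "replicate (Suc (length ls)) t" "n # 1 # ls"] t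
        by (simp del: replicate_Suc)
      finally show ?thesis .
    qed
    ultimately show ?case by blast
  qed
qed

text \<open>The last layer is only ever used linearly, so splitting it costs nothing.\<close>
lemma improve_split_last:
  assumes "weights xs" "0 < layer_poly [n, 1] xs" "\<forall>x\<in>set xs. 0 < x"
  shows "\<exists>ys. weights ys \<and> layer_poly [n, 1] xs < layer_poly [n, 1] ys"
proof -
  obtain pre w where xs: "xs = pre @ [w]" using assms(2) by (cases xs rule: rev_cases) auto
  have w: "0 < w" using assms xs by simp
  have sum: "layer_poly [1] zs = sum_list zs" for zs by (induction zs) auto
  \<comment> \<open>The two halves alone gain \<open>(w/2) ^ n * (w/2)\<close>; entries in
    \<open>zs\<close> only see the sum of what follows, which is unchanged.\<close>
  have "layer_poly [n, 1] (zs @ [w]) < layer_poly [n, 1] (zs @ [w/2, w/2])" for zs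
  proof (induction zs)
    case (Cons z zs)
    have "layer_poly [1] (zs @ [w]) = layer_poly [1] (zs @ [w/2, w/2])"
      unfolding sum by simp
    thus ?case using Cons by simp
  qed (use w in simp)
  moreover have "weights (pre @ [w/2, w/2])"
    using assms(1) w unfolding xs weights_def by auto
  ultimately show ?thesis unfolding xs by blast
qed

text \<open>Every copy lost by merging has its first layer before the dominant one, hence is
  exponentially rare.\<close>
lemma improve_merge_prefix:
  assumes xs: "weights (pre @ M # post)" and M: "3/4 < M" and pre: "0 < sum_list pre"
    and es: "\<forall>e\<in>set es. 0 < e"
    and big: "(3/4) ^ Suc m < layer_poly (Suc (Suc m) # es) (pre @ M # post)"
  shows "\<exists>ys. weights ys \<and>
    layer_poly (Suc (Suc m) # es) (pre @ M # post) < layer_poly (Suc (Suc m) # es) ys"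
proof -
  let ?n = "Suc (Suc m)"
  let ?P = "layer_poly (?n # es)"
  define y where "y = sum_list pre"
  define z where "z = sum_list post"
  define Q where "Q = layer_poly es post"
  have nn: "\<forall>x\<in>set (pre @ M # post). 0 \<le> x" and sum: "y + M + z = 1"
    using xs unfolding weights_def y_def z_def by (auto simp: algebra_simps)
  have y: "0 < y" and z: "0 \<le> z" using pre nn unfolding y_def z_def by (auto intro!: sum_list_nonneg)
  have Q: "0 \<le> Q" unfolding Q_def using nn by (intro layer_poly_nonneg) auto
  \<comment> \<open>The three summands belong to a first pattern layer in \<open>pre\<close>, in
    \<open>M\<close> and in \<open>post\<close>.\<close>
  have old: "?P (pre @ M # post) \<le> y ^ ?n + M ^ ?n * Q + ?P post"
    using layer_poly_append_le[OF nn, of ?n es] es sum unfolding y_def z_def Q_def by simp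
  have "?P post \<le> z ^ ?n"
    using layer_poly_append_le[of post "[]" ?n es] nn es sum y M
    unfolding z_def y_def by simp
  moreover have "y ^ ?n + z ^ ?n \<le> (y + z) ^ ?n"
    using y z by (intro power_add_superadditive) auto
  moreover have "(y + z) ^ ?n \<le> (1/4) ^ ?n"
    using y z sum M by (intro power_mono) auto
  \<comment> \<open>Outside \<open>M\<close> there is weight below \<open>1/4\<close> in total, so
    nearly all of the assumed value must come from terms with first layer \<open>M\<close>.\<close>
  ultimately have "(3/4) ^ Suc m < (1/4) ^ ?n + M ^ ?n * Q"
    using old big by linarith
  moreover have "(1/4) ^ ?n + (1/4) ^ Suc m \<le> (3/4 :: real) ^ Suc m"
  proof -
    have "(1/4 :: real) ^ m \<le> (3/4) ^ m" by (intro power_mono) auto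
    moreover have "0 \<le> (1/4 :: real) ^ m" by simp
    ultimately show ?thesis unfolding power_Suc by linarith
  qed
  moreover have "M ^ ?n * Q \<le> M ^ Suc m * Q"
    using M y z sum Q by (intro mult_right_mono power_decreasing) auto
  moreover have "y ^ Suc m \<le> (1/4) ^ Suc m"
    using y z sum M by (intro power_mono) auto
  ultimately have "y ^ Suc m < M ^ Suc m * Q" by linarith
  hence "y * y ^ Suc m < y * (M ^ Suc m * Q)" using y by simp
  also have "\<dots> = (y * M ^ Suc m) * Q" by simp
  \<comment> \<open>The right side is the gain from merging. Already its lower bound
    \<open>y * M ^ Suc m * Q\<close> exceeds the \<open>y ^ ?n\<close> that is lost with
    \<open>pre\<close>.\<close>
  also have "\<dots> \<le> ((y + M) ^ ?n - M ^ ?n) * Q"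
  proof -
    have "M ^ Suc m \<le> (y + M) ^ Suc m" using y M by (intro power_mono) auto
    hence "(y + M) * M ^ Suc m \<le> (y + M) * (y + M) ^ Suc m"
      using y M by (intro mult_left_mono) auto
    hence "y * M ^ Suc m \<le> (y + M) ^ ?n - M ^ ?n" by (simp add: algebra_simps)
    thus ?thesis using Q by (rule mult_right_mono)
  qed
  finally have "?P (pre @ M # post) < ?P ((y + M) # post)"
    using old by (simp add: Q_def algebra_simps)
  moreover have "weights ((y + M) # post)"
    using nn sum y unfolding weights_def z_def by auto
  ultimately show ?thesis by blast
qed

text \<open>Behind the dominant layer \<open>M\<close> the layer \<open>w\<close> is used linearly, except in the copies
  whose largest layer it hosts; for large \<open>n\<close> these are rarer than the copies gained by
  splitting it.\<close>
lemma improve_split_second: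
  assumes xs: "weights (M # w # post)" and M: "3/4 < M" and w: "0 < w"
    and ls: "\<forall>l\<in>set ls. 0 < l" and l: "0 < l"
    and n: "3 * (l + 1) \<le> n" and pos: "0 < layer_poly (n # 1 # l # ls) (M # w # post)"
  shows "\<exists>ys. weights ys \<and>
    layer_poly (n # 1 # l # ls) (M # w # post) < layer_poly (n # 1 # l # ls) ys"
proof -
  let ?P = "layer_poly (n # 1 # l # ls)" and ?Q = "layer_poly (1 # l # ls)"
  \<comment> \<open>\<open>B\<close> is the common factor against which cost and gain of the split
    are compared.\<close>
  define B where "B = layer_poly ls post"
  have nn: "\<forall>x\<in>set post. 0 \<le> x" and sum: "M + w + sum_list post = 1"
    using xs unfolding weights_def by auto
  have z: "0 \<le> sum_list post" using nn by (intro sum_list_nonneg) auto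
  have s1: "sum_list post \<le> 1" using sum M w by linarith
  have nonneg: "0 \<le> layer_poly es post" for es using nn by (rule layer_poly_nonneg)
  have lB: "layer_poly (l # ls) post \<le> B"
    unfolding B_def by (rule layer_poly_Cons_le_tail[OF nn s1 l])
  have QB: "?Q post \<le> B"
    using layer_poly_Cons_le_tail[OF nn s1, of 1 "l # ls"] lB by linarith
  have PB: "?P post \<le> B"
    using layer_poly_Cons_le_tail[OF nn s1, of n "1 # l # ls"] QB n by force
  \<comment> \<open>Were \<open>B\<close> zero, the three bounds would make every term in the
    expansion of \<open>?P (M # w # post)\<close> vanish.\<close>
  have "B \<noteq> 0"
  proof
    assume "B = 0"
    hence "layer_poly (l # ls) post = 0" "?Q post = 0" "?P post = 0"
      using lB QB PB nonneg by (simp_all add: order_antisym)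
    thus False using pos unfolding layer_sum.simps by simp
  qed
  moreover have "0 \<le> B" unfolding B_def by (rule nonneg)
  ultimately have B: "0 < B" by simp
  \<comment> \<open>With \<open>w\<close> below \<open>1/4\<close> and \<open>M\<close> above
    \<open>3/4\<close> this reduces to \<open>8 ^ (l + 1) < 3 ^ n\<close>. As
    \<open>8 < 27 = 3 ^ 3\<close>, the hypothesis \<open>3 * (l + 1) \<le> n\<close>
    suffices.\<close>
  have main: "w ^ n < M ^ n * (w/2) ^ (l + 1)"
  proof -
    obtain r where r: "n = l + 1 + r" using n using le_Suc_ex[of "l + 1" n] by auto
    have "w ^ r \<le> (1/4) ^ r" using w sum M z by (intro power_mono) auto
    moreover have "(1/4 :: real) ^ r * 2 ^ (l + 1) < (3/4) ^ n"
    proof -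
      have "(8 :: real) ^ (l + 1) < 27 ^ (l + 1)" by (intro power_strict_mono) auto
      also have "\<dots> = 3 ^ (3 * (l + 1))" unfolding power_mult by simp
      also have "\<dots> \<le> 3 ^ n" using n by (intro power_increasing) auto
      finally have "(4 :: real) ^ (l + 1) * 2 ^ (l + 1) < 3 ^ n"
        by (simp flip: power_mult_distrib)
      thus ?thesis by (simp add: r power_add power_divide field_simps)
    qed
    moreover have "(3/4) ^ n \<le> M ^ n" using M by (intro power_mono) auto
    moreover from calculation(1) have "w ^ r * 2 ^ (l + 1) \<le> (1/4) ^ r * 2 ^ (l + 1)"
      by (rule mult_right_mono) simp
    ultimately have "w ^ r * 2 ^ (l + 1) < M ^ n" by linarith
    hence "(w ^ r * 2 ^ (l + 1)) * (w/2) ^ (l + 1) < M ^ n * (w/2) ^ (l + 1)"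
      using w by (intro mult_strict_right_mono) auto
    moreover have "(w ^ r * 2 ^ (l + 1)) * (w/2) ^ (l + 1) = w ^ n"
      by (simp add: r power_add power_divide)
    ultimately show ?thesis by simp
  qed
  have "w ^ n * ?Q post \<le> w ^ n * B" using QB w by (intro mult_left_mono) auto
  also have "\<dots> < M ^ n * (w/2) ^ (l + 1) * B" using main B by simp
  finally have less: "w ^ n * ?Q post < M ^ n * (w/2) ^ (l + 1) * B" .
  have "?P (M # w # post) =
      M ^ n * (w * layer_poly (l # ls) post + ?Q post) + w ^ n * ?Q post + ?P post" by simp
  also have "\<dots> < M ^ n * (w * layer_poly (l # ls) post + ?Q post)
      + M ^ n * (w/2) ^ (l + 1) * B + ?P post" using less by simp
  \<comment> \<open>The additional term places the singleton in the first half of \<open>w\<close>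
    and the layer of size \<open>l\<close> in the second; the terms that use one half linearly add
    up to those of \<open>w\<close>.\<close>
  also have "\<dots> = M ^ n * ?Q (w/2 # w/2 # post) + ?P post"
    by (simp add: B_def algebra_simps)
  also have "\<dots> \<le> ?P (M # w/2 # w/2 # post)"
    using nonneg[of "l # ls"] nonneg[of "1 # l # ls"] nonneg[of ls] w
    by (auto intro!: add_nonneg_nonneg mult_nonneg_nonneg)
  finally have "?P (M # w # post) < ?P (M # w/2 # w/2 # post)" .
  moreover have "weights (M # w/2 # w/2 # post)"
    using xs w unfolding weights_def by auto
  ultimately show ?thesis by blast
qed

lemma sum_list_filter_nonzero: "sum_list (filter (\<lambda>x. x \<noteq> 0) xs) = sum_list xs"
  by (induction xs) auto

text \<open>The position of the dominant weight, and whether \<open>ls\<close> is empty, decide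
  which of the three moves applies.\<close>

lemma improve_large:
  assumes xs: "weights xs" and ls: "\<forall>l\<in>set ls. 0 < l"
    and n: "2 \<le> n" "ls \<noteq> [] \<Longrightarrow> 3 * (hd ls + 1) \<le> n"
    and big: "(3/4) ^ (n - 1) < layer_poly (n # 1 # ls) xs"
  shows "\<exists>ys. weights ys \<and> layer_poly (n # 1 # ls) xs < layer_poly (n # 1 # ls) ys"
proof -
  let ?P = "layer_poly (n # 1 # ls)"
  \<comment> \<open>Zero weights are dropped so that whatever is merged or split has positive
    weight.\<close>
  define zs where "zs = filter (\<lambda>x. x \<noteq> 0) xs"
  have es: "\<forall>e\<in>set (n # 1 # ls). 0 < e" using ls n by auto
  have eq: "?P zs = ?P xs" unfolding zs_def by (rule layer_sum_filter) (use es in auto)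
  have zs: "weights zs" "\<forall>x\<in>set zs. 0 < x"
    using xs unfolding weights_def zs_def by (auto simp: sum_list_filter_nonzero order_less_le)
  have pos: "0 < ?P zs" using big eq using zero_le_power[of "3/4 :: real" "n - 1"] by linarith
  obtain m where m: "n = Suc (Suc m)" using n(1) using le_Suc_ex[of 2 n] by auto
  have "zs \<noteq> []" using pos by auto
  define M where "M = Max (set zs)"
  have Min: "M \<in> set zs" unfolding M_def using \<open>zs \<noteq> []\<close> by simp
  have "?P zs \<le> M ^ Suc m * sum_list zs" unfolding m
    by (rule layer_poly_le_Max) (use zs es in \<open>auto simp: M_def weights_def intro: less_imp_le\<close>)
  hence "(3/4) ^ Suc m < M ^ Suc m" using big zs eq by (simp add: weights_def m)
  hence M: "3/4 < M" by (rule power_less_imp_less_base) (use Min zs in \<open>auto intro: less_imp_le\<close>)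
  obtain pre post where split: "zs = pre @ M # post" using Min by (meson split_list)
  show ?thesis
  proof (cases "pre = []")
    case False
    then obtain p pre' where "pre = p # pre'" by (cases pre) auto
    moreover from this have "0 \<le> sum_list pre'"
      using zs(2) split by (intro sum_list_nonneg) (auto intro: less_imp_le)
    ultimately have "0 < sum_list pre" using zs(2) split by auto
    thus ?thesis
      using improve_merge_prefix[of pre M post "1 # ls" m] zs M big es eq
      unfolding split m by simp
  next
    case True
    show ?thesis
    proof (cases ls)
      case Nil
      thus ?thesis using improve_split_last[OF zs(1) _ zs(2), of n] pos eq by simp
    next
      case (Cons l ls')
      obtain w post' where "post = w # post'" using pos split True by (cases post) auto
      thus ?thesis
        using improve_split_second[of M w post' ls' l n] zs M ls n(2) pos eq
        unfolding split True Cons by auto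
    qed
  qed
qed

theorem layer_poly_improvable:
  assumes "\<forall>l\<in>set ls. 0 < l"
  shows "\<forall>\<^sub>F n in sequentially. \<forall>xs. weights xs \<longrightarrow>
    (\<exists>ys. weights ys \<and> layer_poly (n # 1 # ls) xs < layer_poly (n # 1 # ls) ys)"
  \<comment> \<open>For empty \<open>ls\<close> the number \<open>hd ls\<close> is unspecified, but
    \<open>n\<close> still exceeds it eventually.\<close>
  using improve_small[OF assms] eventually_ge_at_top[of 2]
    eventually_ge_at_top[of "3 * (hd ls + 1)"]
proof eventually_elim
  case (elim n)
  show ?case
  proof (intro allI impI)
    fix xs assume xs: "weights xs"
    show "\<exists>ys. weights ys \<and> layer_poly (n # 1 # ls) xs < layer_poly (n # 1 # ls) ys"
    proof (cases "(3/4) ^ (n - 1) < layer_poly (n # 1 # ls) xs")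
      case True
      show ?thesis by (rule improve_large[OF xs assms elim(2) elim(3) True])
    next
      case False
      thus ?thesis using elim(1) by (meson linorder_not_le order.strict_trans1)
    qed
  qed
qed

section \<open>Copies of layered patterns in layered permutations\<close>

text \<open>Points count from \<open>1\<close>, layers from \<open>0\<close>. Making the layer a
  recursive function of the point allows induction over \<open>bs\<close>.\<close>

fun layer_index :: "nat list \<Rightarrow> nat \<Rightarrow> nat" where
  "layer_index [] x = 0"
| "layer_index (b # bs) x = (if x \<le> b then 0 else Suc (layer_index bs (x - b)))"

lemma mem_layer_iff:
  assumes "1 \<le> x" "j < length bs"
  shows "x \<in> layer bs j \<longleftrightarrow> layer_index bs x = j"
  using assms
proof (induction bs x arbitrary: j rule: layer_index.induct)
  case (2 b bs x)
  show ?case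
  proof (cases j)
    case 0
    thus ?thesis using 2 by (simp add: layer_def)
  next
    case (Suc i)
    have "x \<in> layer (b # bs) j \<longleftrightarrow> b < x \<and> x - b \<in> layer bs i"
      by (auto simp: layer_def Suc)
    thus ?thesis using 2 Suc by auto
  qed
qed simp

lemma layer_index_less: "1 \<le> x \<Longrightarrow> x \<le> sum_list bs \<Longrightarrow> layer_index bs x < length bs"
  by (induction bs x rule: layer_index.induct) auto

lemma layer_index_mono: "x \<le> y \<Longrightarrow> layer_index bs x \<le> layer_index bs y"
  by (induction bs arbitrary: x y) auto

lemma layer_subset: "j < length bs \<Longrightarrow> layer bs j \<subseteq> {1..sum_list bs}"
proof -
  have "sum_list (take (Suc j) bs) \<le> sum_list bs"
    by (metis append_take_drop_id le_add1 sum_list_append)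
  thus ?thesis by (auto simp: layer_def)
qed

text \<open>The order that the values of a layered permutation put on its positions.\<close>

definition layer_less :: "nat list \<Rightarrow> nat \<Rightarrow> nat \<Rightarrow> bool" where
  "layer_less bs x y \<longleftrightarrow> (if layer_index bs x = layer_index bs y then y < x else x < y)"

text \<open>Describing the whole order of the values at once gives layeredness the form in which
  \<open>induces\<close> compares patterns.\<close>

lemma has_layers_iff:
  "has_layers m \<sigma> bs \<longleftrightarrow> \<sigma> permutes {1..m} \<and> sum_list bs = m \<and> (\<forall>b\<in>set bs. 0 < b) \<and>
     (\<forall>x\<in>{1..m}. \<forall>y\<in>{1..m}. \<sigma> x < \<sigma> y \<longleftrightarrow> layer_less bs x y)" (is "?L \<longleftrightarrow> ?R")
proof
  assume L: ?L
  have sum: "sum_list bs = m" using L by (rule has_layersD)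
  have "\<sigma> x < \<sigma> y \<longleftrightarrow> layer_less bs x y" if xy: "x \<in> {1..m}" "y \<in> {1..m}" for x y
  proof -
    let ?i = "layer_index bs x" and ?j = "layer_index bs y"
    have len: "?i < length bs" "?j < length bs" using xy sum by (auto intro: layer_index_less)
    have mem: "x \<in> layer bs ?i" "y \<in> layer bs ?j" using mem_layer_iff len xy by auto
    consider "?i = ?j" | "?i < ?j" | "?j < ?i" by linarith
    thus ?thesis
    proof cases
      case 1
      hence "x < y \<Longrightarrow> \<sigma> y < \<sigma> x" "y < x \<Longrightarrow> \<sigma> x < \<sigma> y"
        using layersD_dec[OF L len(1)] mem by auto
      thus ?thesis using 1 by (cases x y rule: linorder_cases) (auto simp: layer_less_def)
    next
      case 2
      hence "x < y" using layer_index_mono[of y x bs] by (meson linorder_not_le)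
      thus ?thesis using layersD_inc[OF L len 2 mem] 2 by (simp add: layer_less_def)
    next
      case 3
      hence "y < x" using layer_index_mono[of x y bs] by (meson linorder_not_le)
      thus ?thesis using layersD_inc[OF L len(2,1) 3 mem(2,1)] 3 by (simp add: layer_less_def)
    qed
  qed
  thus ?R using L unfolding has_layers_def by auto
next
  assume R: ?R
  have mem: "x \<in> {1..m} \<and> layer_index bs x = j" if "j < length bs" "x \<in> layer bs j" for x j
    using layer_subset[OF that(1)] that(2) mem_layer_iff[OF _ that(1)] R by auto
  have dec: "\<sigma> x' < \<sigma> x" if "j < length bs" "x \<in> layer bs j" "x' \<in> layer bs j" "x < x'" for j x x'
    using R mem[OF that(1,2)] mem[OF that(1,3)] that(4) by (simp add: layer_less_def)
  have inc: "\<sigma> x < \<sigma> x'"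
    if "j < length bs" "j' < length bs" "j < j'" "x \<in> layer bs j" "x' \<in> layer bs j'" for j j' x x'
  proof -
    have "x < x'" using mem[OF that(1,4)] mem[OF that(2,5)] layer_index_mono[of x' x bs] that(3)
      by (metis linorder_not_le)
    thus ?thesis using R mem[OF that(1,4)] mem[OF that(2,5)] that(3) by (simp add: layer_less_def)
  qed
  show ?L unfolding has_layers_def
    using R by (elim conjE, intro conjI allI impI ballI)
      (assumption | erule (1) bspec | erule (3) dec | erule (4) inc)+
qed

section \<open>Existence of layered permutations with prescribed layers\<close>

fun reverse_layers :: "nat list \<Rightarrow> nat \<Rightarrow> nat" where
  "reverse_layers [] x = x"
| "reverse_layers (b # bs) x = (if x \<le> b then b + 1 - x else b + reverse_layers bs (x - b))"

lemma reverse_layers_range: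
  "1 \<le> x \<Longrightarrow> x \<le> sum_list bs \<Longrightarrow> 1 \<le> reverse_layers bs x \<and> reverse_layers bs x \<le> sum_list bs"
proof (induction bs x rule: reverse_layers.induct)
  case (2 b bs x)
  show ?case
  proof (cases "x \<le> b")
    case False
    thus ?thesis using 2 by (simp add: trans_le_add2)
  qed (use 2 in auto)
qed auto

lemma reverse_layers_less_iff:
  assumes "x \<in> {1..sum_list bs}" "y \<in> {1..sum_list bs}"
  shows "reverse_layers bs x < reverse_layers bs y \<longleftrightarrow> layer_less bs x y"
  using assms
proof (induction bs arbitrary: x y)
  case (Cons b bs)
  show ?case
  proof (cases "x \<le> b \<or> y \<le> b")
    case True
    have *: "1 \<le> reverse_layers bs (z - b)" if "z \<in> {1..sum_list (b # bs)}" "\<not> z \<le> b" for z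
      using reverse_layers_range[of "z - b" bs] that by auto
    show ?thesis using Cons.prems *[of x] *[of y] True
      by (cases "x \<le> b"; cases "y \<le> b") (auto simp: layer_less_def)
  next
    case False
    hence "x - b \<in> {1..sum_list bs}" "y - b \<in> {1..sum_list bs}"
      "x - b < y - b \<longleftrightarrow> x < y" "y - b < x - b \<longleftrightarrow> y < x"
      using Cons.prems by auto
    thus ?thesis using False Cons.IH[of "x - b" "y - b"] by (simp add: layer_less_def)
  qed
qed simp

lemma ex_has_layers:
  assumes "\<forall>b\<in>set bs. 0 < b"
  shows "\<exists>\<pi>. has_layers (sum_list bs) \<pi> bs"
proof -
  let ?S = "{1..sum_list bs}"
  define \<pi> where "\<pi> = (\<lambda>x. if x \<in> ?S then reverse_layers bs x else x)"
  have less: "\<pi> x < \<pi> y \<longleftrightarrow> layer_less bs x y" if "x \<in> ?S" "y \<in> ?S" for x y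
    using reverse_layers_less_iff[OF that] that by (simp add: \<pi>_def)
  \<comment> \<open>Distinct positions are always related by \<open>layer_less\<close> in one
    direction, so their values differ.\<close>
  have "inj_on \<pi> ?S"
  proof (rule inj_onI)
    fix x y assume xy: "x \<in> ?S" "y \<in> ?S" and "\<pi> x = \<pi> y"
    hence "\<not> layer_less bs x y" "\<not> layer_less bs y x" using less by (metis less_irrefl)+
    thus "x = y" unfolding layer_less_def by (metis linorder_neqE_nat)
  qed
  moreover have "\<pi> ` ?S \<subseteq> ?S" using reverse_layers_range by (auto simp: \<pi>_def)
  ultimately have "bij_betw \<pi> ?S ?S"
    by (simp add: bij_betw_def endo_inj_surj)
  hence "\<pi> permutes ?S" by (rule bij_imp_permutes) (auto simp: \<pi>_def)
  thus ?thesis using less assms unfolding has_layers_iff by blast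
qed

section \<open>Induced patterns and their layer sizes\<close>

text \<open>The sizes of the nonempty intersections of \<open>A\<close> with consecutive intervals of sizes
  \<open>bs\<close>, starting after \<open>a\<close>.\<close>
fun profile :: "nat \<Rightarrow> nat list \<Rightarrow> nat set \<Rightarrow> nat list" where
  "profile a [] A = []"
| "profile a (b # bs) A =
     (if A \<inter> {a<..a + b} = {} then [] else [card (A \<inter> {a<..a + b})]) @ profile (a + b) bs A"

lemma profile_cong: "A \<inter> {a<..} = B \<inter> {a<..} \<Longrightarrow> profile a bs A = profile a bs B"
proof (induction bs arbitrary: a)
  case (Cons b bs)
  have "A \<inter> {a<..a + b} = (A \<inter> {a<..}) \<inter> {a<..a + b}" by auto
  also have "\<dots> = B \<inter> {a<..a + b}" unfolding Cons.prems by auto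
  finally have 1: "A \<inter> {a<..a + b} = B \<inter> {a<..a + b}" .
  have "A \<inter> {a + b<..} = (A \<inter> {a<..}) \<inter> {a + b<..}" by auto
  also have "\<dots> = B \<inter> {a + b<..}" unfolding Cons.prems by auto
  finally have "profile (a + b) bs A = profile (a + b) bs B" by (rule Cons.IH)
  thus ?case using 1 by simp
qed simp

lemma profile_pos: "e \<in> set (profile a bs A) \<Longrightarrow> 0 < e"
proof (induction bs arbitrary: a)
  case (Cons b bs)
  have "0 < card (A \<inter> {a<..a + b})" if "A \<inter> {a<..a + b} \<noteq> {}"
    using that unfolding card_gt_0_iff by simp
  thus ?case using Cons by (auto simp del: card_gt_0_iff split: if_splits)
qed simp

lemma subset_split:
  fixes A :: "nat set"
  assumes "A \<subseteq> {a<..a + (b + c)}"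
  shows "A = A \<inter> {a<..a + b} \<union> A \<inter> {a + b<..}" "A \<inter> {a<..a + b} \<inter> (A \<inter> {a + b<..}) = {}"
    "A \<inter> {a + b<..} \<subseteq> {a + b<..a + b + c}"
  using assms by auto

lemma sum_list_profile:
  "A \<subseteq> {a<..a + sum_list bs} \<Longrightarrow> sum_list (profile a bs A) = card A"
proof (induction bs arbitrary: a A)
  case (Cons b bs)
  have sub: "A \<subseteq> {a<..a + (b + sum_list bs)}" using Cons.prems by simp
  have fin: "finite A" using sub by (rule finite_subset) simp
  note split = subset_split[OF sub]
  have "profile (a + b) bs A = profile (a + b) bs (A \<inter> {a + b<..})"
    by (rule profile_cong) auto
  hence "sum_list (profile (a + b) bs A) = card (A \<inter> {a + b<..})"
    using Cons.IH[OF split(3)] by simp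
  moreover have "card A = card (A \<inter> {a<..a + b}) + card (A \<inter> {a + b<..})"
    by (subst split(1), rule card_Un_disjoint) (use fin split(2) in auto)
  ultimately show ?case by simp
qed simp

lemma sorted_list_of_set_Un_less:
  fixes A B :: "nat set"
  assumes "finite A" "finite B" "\<And>x y. x \<in> A \<Longrightarrow> y \<in> B \<Longrightarrow> x < y"
  shows "sorted_list_of_set (A \<union> B) = sorted_list_of_set A @ sorted_list_of_set B"
proof -
  have "A \<inter> B = {}" using assms(3) by blast
  thus ?thesis
    by (intro sorted_distinct_set_unique)
       (use assms in \<open>simp_all add: sorted_append less_imp_le\<close>)
qed

text \<open>The profile drops the layers that \<open>A\<close> misses. This renumbers the layers but
  neither merges nor separates points, so only equality of indices is compared.\<close>

lemma layer_index_profile: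
  assumes "A \<subseteq> {a<..a + sum_list bs}" "i < card A" "j < card A"
  shows "layer_index (profile a bs A) (Suc i) = layer_index (profile a bs A) (Suc j) \<longleftrightarrow>
    layer_index bs (sorted_list_of_set A ! i - a) = layer_index bs (sorted_list_of_set A ! j - a)"
  using assms
proof (induction bs arbitrary: a A i j)
  case (Cons b bs)
  define A1 A2 where "A1 = A \<inter> {a<..a + b}" and "A2 = A \<inter> {a + b<..}"
  have sub: "A \<subseteq> {a<..a + (b + sum_list bs)}" using Cons.prems by simp
  have fin: "finite A" using sub by (rule finite_subset) simp
  hence fin': "finite A1" "finite A2" unfolding A1_def A2_def by auto
  note split = subset_split[OF sub, folded A1_def A2_def]
  have p: "profile (a + b) bs A = profile (a + b) bs A2"
    unfolding A2_def by (rule profile_cong) auto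
  have prof: "profile a (b # bs) A = (if card A1 = 0 then [] else [card A1]) @ profile (a + b) bs A2"
    using fin' p by (simp add: A1_def)
  \<comment> \<open>If \<open>A\<close> misses the first interval, the profile has no entry for it,
    hence \<open>id\<close> in place of \<open>Suc\<close>; both are injective.\<close>
  have idx: "layer_index (profile a (b # bs) A) (Suc k) =
      (if k < card A1 then 0
       else (if card A1 = 0 then id else Suc) (layer_index (profile (a + b) bs A2) (Suc (k - card A1))))" for k
    unfolding prof by (auto simp: Suc_diff_le not_less)
  have list: "sorted_list_of_set A = sorted_list_of_set A1 @ sorted_list_of_set A2"
    by (subst split(1), rule sorted_list_of_set_Un_less) (use fin' in \<open>auto simp: A1_def A2_def\<close>)
  have card: "card A = card A1 + card A2"
    by (subst split(1), rule card_Un_disjoint) (use fin' split(2) in auto)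
  have nth1: "sorted_list_of_set A ! k - a \<le> b" if "k < card A1" for k
  proof -
    have "sorted_list_of_set A1 ! k \<in> A1"
      using nth_mem[of k "sorted_list_of_set A1"] that fin' by simp
    thus ?thesis using that by (auto simp: list nth_append A1_def)
  qed
  have nth2: "b < sorted_list_of_set A ! k - a"
    "sorted_list_of_set A ! k - a - b = sorted_list_of_set A2 ! (k - card A1) - (a + b)"
    if "\<not> k < card A1" "k < card A" for k
  proof -
    have "sorted_list_of_set A2 ! (k - card A1) \<in> A2"
      using nth_mem[of "k - card A1" "sorted_list_of_set A2"] that card fin' by simp
    thus "b < sorted_list_of_set A ! k - a"
      "sorted_list_of_set A ! k - a - b = sorted_list_of_set A2 ! (k - card A1) - (a + b)"
      using that by (auto simp: list nth_append A2_def)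
  qed
  have idx': "layer_index (b # bs) (sorted_list_of_set A ! k - a) =
      (if k < card A1 then 0
       else Suc (layer_index bs (sorted_list_of_set A2 ! (k - card A1) - (a + b))))"
    if "k < card A" for k
    using nth1[of k] nth2[of k] that by (cases "k < card A1") simp_all
  have IH: "layer_index (profile (a + b) bs A2) (Suc (i - card A1)) =
      layer_index (profile (a + b) bs A2) (Suc (j - card A1)) \<longleftrightarrow>
    layer_index bs (sorted_list_of_set A2 ! (i - card A1) - (a + b)) =
      layer_index bs (sorted_list_of_set A2 ! (j - card A1) - (a + b))"
    if "\<not> i < card A1" "\<not> j < card A1"
    using Cons.prems that card by (intro Cons.IH split(3)) auto
  show ?case
    unfolding idx idx'[OF Cons.prems(2)] idx'[OF Cons.prems(3)] using IH by auto
qed simp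

lemma strict_mono_nth_point:
  assumes "finite A" "1 \<le> i" "i < j" "j \<le> card A"
  shows "nth_point A i < nth_point A j"
  unfolding nth_point_def
  by (rule sorted_wrt_nth_less[OF strict_sorted_list_of_set]) (use assms in auto)

lemma nth_point_mem:
  assumes "finite A" "j \<in> {1..card A}"
  shows "nth_point A j \<in> A"
proof -
  have "j - 1 < length (sorted_list_of_set A)" using assms by auto
  from nth_mem[OF this] show ?thesis using assms(1) by (simp add: nth_point_def)
qed

text \<open>\<open>layer_less\<close> depends only on the order of two points and on whether they
  share a layer, and \<open>nth_point A\<close> preserves both.\<close>

lemma layer_less_profile:
  assumes A: "A \<subseteq> {1..sum_list bs}" and ij: "i \<in> {1..card A}" "j \<in> {1..card A}"
  shows "layer_less (profile 0 bs A) i j \<longleftrightarrow> layer_less bs (nth_point A i) (nth_point A j)"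
proof -
  have fin: "finite A" using A by (rule finite_subset) simp
  have A': "A \<subseteq> {0<..0 + sum_list bs}" using A by auto
  have "layer_index (profile 0 bs A) i = layer_index (profile 0 bs A) j \<longleftrightarrow>
    layer_index bs (nth_point A i) = layer_index bs (nth_point A j)"
    using layer_index_profile[OF A', of "i - 1" "j - 1"] ij by (auto simp: nth_point_def)
  moreover have "i < j \<longleftrightarrow> nth_point A i < nth_point A j" if "i \<in> {1..card A}" "j \<in> {1..card A}" for i j
    using strict_mono_nth_point[OF fin, of i j] strict_mono_nth_point[OF fin, of j i] that
    by (cases i j rule: linorder_cases) auto
  ultimately show ?thesis using ij by (simp add: layer_less_def)
qed

text \<open>The pattern that \<open>A\<close> induces is layered with layer sizes
  \<open>profile 0 bs A\<close>. Since a layered permutation determines its layers, comparing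
  patterns means comparing lists.\<close>

lemma induces_layered_iff:
  assumes \<pi>: "has_layers N \<pi> bs" and \<sigma>: "has_layers s \<sigma> es" and A: "A \<subseteq> {1..N}"
  shows "card A = s \<and> induces \<pi> A \<sigma> \<longleftrightarrow> profile 0 bs A = es"
proof -
  have N: "sum_list bs = N" using \<pi> by (rule has_layersD)
  have fin: "finite A" using A by (rule finite_subset) simp
  have card: "sum_list (profile 0 bs A) = card A"
    by (rule sum_list_profile) (use A N in auto)
  have "induces \<pi> A \<sigma> \<longleftrightarrow> \<sigma> permutes {1..card A} \<and> (\<forall>i\<in>{1..card A}. \<forall>j\<in>{1..card A}.
      \<sigma> i < \<sigma> j \<longleftrightarrow> layer_less bs (nth_point A i) (nth_point A j))"
    using nth_point_mem[OF fin] A \<pi> unfolding induces_def has_layers_iff by (auto 0 4 simp: subset_iff)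
  also have "\<dots> \<longleftrightarrow> has_layers (card A) \<sigma> (profile 0 bs A)"
    using layer_less_profile[of A bs] A N card profile_pos unfolding has_layers_iff by blast
  finally have "card A = s \<and> induces \<pi> A \<sigma> \<longleftrightarrow> card A = s \<and> has_layers s \<sigma> (profile 0 bs A)"
    by blast
  also have "\<dots> \<longleftrightarrow> profile 0 bs A = es"
    using has_layers_unique[OF \<sigma>, of "profile 0 bs A"] \<sigma> card has_layersD(1)[OF \<sigma>] by metis
  finally show ?thesis .
qed

text \<open>The recursion of \<open>layer_sum\<close> distinguishes whether the first interval hosts
  the first layer of the pattern or is missed by \<open>A\<close>. Positive sizes keep the two cases
  disjoint.\<close>

lemma card_profile:
  assumes "\<forall>e\<in>set es. 0 < e"
  shows "card {A. A \<subseteq> {a<..a + sum_list bs} \<and> profile a bs A = es} = layer_sum (choose) es bs"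
  using assms
proof (induction bs arbitrary: a es)
  case Nil
  thus ?case by (cases es) auto
next
  case (Cons b bs)
  show ?case
  proof (cases es)
    case Nil
    have "{A. A \<subseteq> {a<..a + sum_list (b # bs)} \<and> profile a (b # bs) A = []} = {{}}"
      (is "?X = _")
    proof
      show "?X \<subseteq> {{}}"
      proof
        fix A assume "A \<in> ?X"
        hence A: "A \<subseteq> {a<..a + sum_list (b # bs)}" "profile a (b # bs) A = []" by auto
        hence "card A = 0" using sum_list_profile[OF A(1)] by simp
        thus "A \<in> {{}}" using finite_subset[OF A(1)] by simp
      qed
      have "profile c ds {} = []" for c ds by (induction ds arbitrary: c) auto
      thus "{{}} \<subseteq> ?X" by simp
    qed
    thus ?thesis using Nil by simp
  next
    case (Cons e es')
    define S where "S es = {A. A \<subseteq> {a + b<..a + b + sum_list bs} \<and> profile (a + b) bs A = es}" for es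
    define T where "T = {A. A \<subseteq> {a<..a + b} \<and> card A = e}"
    let ?X = "{A. A \<subseteq> {a<..a + sum_list (b # bs)} \<and> profile a (b # bs) A = e # es'}"
    have e: "0 < e" using Cons Cons.prems by simp
    have prof: "profile a (b # bs) (A1 \<union> A2) =
        (if A1 = {} then [] else [card A1]) @ profile (a + b) bs A2"
      if "A1 \<subseteq> {a<..a + b}" "A2 \<subseteq> {a + b<..a + b + sum_list bs}" for A1 A2
    proof -
      have "(A1 \<union> A2) \<inter> {a<..a + b} = A1" using that by auto
      moreover have "profile (a + b) bs (A1 \<union> A2) = profile (a + b) bs A2"
        by (rule profile_cong) (use that in auto)
      ultimately show ?thesis by simp
    qed
    have finS: "finite (S es)" for es unfolding S_def by simp
    have finT: "finite T" unfolding T_def by simp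
    have X: "?X = (\<lambda>(A1, A2). A1 \<union> A2) ` (T \<times> S es') \<union> S (e # es')"
    proof (intro equalityI subsetI)
      fix A assume "A \<in> ?X"
      hence A: "A \<subseteq> {a<..a + (b + sum_list bs)}" "profile a (b # bs) A = e # es'" by auto
      let ?A1 = "A \<inter> {a<..a + b}" and ?A2 = "A \<inter> {a + b<..}"
      note split = subset_split[OF A(1)]
      have parts: "(if ?A1 = {} then [] else [card ?A1]) @ profile (a + b) bs ?A2 = e # es'"
        using prof[OF _ split(3), of ?A1] A(2) split(1) by simp
      thus "A \<in> (\<lambda>(A1, A2). A1 \<union> A2) ` (T \<times> S es') \<union> S (e # es')"
      proof (cases "?A1 = {}")
        case True
        hence "A = ?A2" using split(1) by auto
        thus ?thesis using True split(3) parts unfolding S_def by auto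
      next
        case False
        hence "?A1 \<in> T" "?A2 \<in> S es'" using split(3) parts unfolding S_def T_def by auto
        thus ?thesis using split(1) by (intro UnI1 image_eqI[of _ _ "(?A1, ?A2)"]) auto
      qed
    next
      fix A assume "A \<in> (\<lambda>(A1, A2). A1 \<union> A2) ` (T \<times> S es') \<union> S (e # es')"
      then obtain A1 A2 where "A = A1 \<union> A2" "A1 \<in> T \<and> A2 \<in> S es' \<or> A1 = {} \<and> A2 \<in> S (e # es')"
        by auto
      moreover from this e have "profile a (b # bs) A = e # es'"
        using prof[of A1 A2] unfolding S_def T_def by (auto simp del: profile.simps)
      ultimately show "A \<in> ?X" unfolding S_def T_def by auto
    qed
    have disj: "(\<lambda>(A1, A2). A1 \<union> A2) ` (T \<times> S es') \<inter> S (e # es') = {}"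
    proof -
      have "\<not> A1 \<union> A2 \<subseteq> {a + b<..}" if "A1 \<in> T" for A1 A2
      proof -
        have "A1 \<noteq> {}" "A1 \<subseteq> {a<..a + b}" using that e unfolding T_def by auto
        thus ?thesis by fastforce
      qed
      thus ?thesis unfolding S_def by fastforce
    qed
    have inj: "inj_on (\<lambda>(A1, A2). A1 \<union> A2) (T \<times> S es')"
    proof (rule inj_onI, clarify)
      fix A1 A2 B1 B2 assume *: "A1 \<in> T" "A2 \<in> S es'" "B1 \<in> T" "B2 \<in> S es'" "A1 \<union> A2 = B1 \<union> B2"
      have "A1 = (A1 \<union> A2) \<inter> {..a + b}" "B1 = (B1 \<union> B2) \<inter> {..a + b}"
        "A2 = (A1 \<union> A2) \<inter> {a + b<..}" "B2 = (B1 \<union> B2) \<inter> {a + b<..}"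
        using *(1-4) unfolding S_def T_def by auto
      thus "A1 = B1 \<and> A2 = B2" using *(5) by metis
    qed
    have "card ?X = card T * card (S es') + card (S (e # es'))"
      unfolding X using finS finT disj inj
      by (subst card_Un_disjoint) (auto simp: card_image card_cartesian_product)
    also have "card T = b choose e" unfolding T_def by (subst n_subsets) auto
    also have "card (S es') = layer_sum (choose) es' bs"
      unfolding S_def using Cons Cons.prems by (intro Cons.IH) auto
    also have "card (S (e # es')) = layer_sum (choose) (e # es') bs"
      unfolding S_def using Cons Cons.prems by (intro Cons.IH) auto
    finally show ?thesis using Cons by simp
  qed
qed

theorem density_layered:
  assumes \<pi>: "has_layers N \<pi> bs" and \<sigma>: "has_layers s \<sigma> es"
  shows "density s \<sigma> N \<pi> = real (layer_sum (choose) es bs) / real (N choose s)"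
proof -
  have N: "sum_list bs = N" using \<pi> by (rule has_layersD)
  have "{A. A \<subseteq> {1..N} \<and> card A = s \<and> induces \<pi> A \<sigma>}
      = {A. A \<subseteq> {0<..0 + sum_list bs} \<and> profile 0 bs A = es}"
  proof -
    have "{1..N} = {0<..0 + sum_list bs}" using N by auto
    thus ?thesis using induces_layered_iff[OF \<pi> \<sigma>] by auto
  qed
  thus ?thesis unfolding density_def
    using card_profile[of es 0 bs] has_layersD(2)[OF \<sigma>] by (simp add: n_subsets)
qed

section \<open>Existence of the packing density\<close>

abbreviation occurrences :: "nat \<Rightarrow> (nat \<Rightarrow> nat) \<Rightarrow> nat \<Rightarrow> (nat \<Rightarrow> nat) \<Rightarrow> nat set set" where
  "occurrences s \<sigma> n \<pi> \<equiv> {A. A \<subseteq> {1..n} \<and> card A = s \<and> induces \<pi> A \<sigma>}"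

lemma density_eq: "density s \<sigma> n \<pi> = real (card (occurrences s \<sigma> n \<pi>)) / real (n choose s)"
  unfolding density_def by (simp add: n_subsets)

section \<open>Deleting a point of a permutation\<close>

lemma sorted_list_of_set_image_strict_mono:
  fixes f :: "nat \<Rightarrow> nat"
  assumes "strict_mono f" "finite A"
  shows "sorted_list_of_set (f ` A) = map f (sorted_list_of_set A)"
proof (rule sorted_distinct_set_unique)
  show "sorted (map f (sorted_list_of_set A))"
    using assms(1) by (intro sorted_map_mono) (auto simp: strict_mono_mono mono_imp_mono_on)
  show "distinct (map f (sorted_list_of_set A))"
    using strict_mono_imp_inj_on[OF assms(1)] by (simp add: distinct_map inj_on_def)
qed (use assms in auto)

lemma nth_point_image:
  assumes "strict_mono f" "finite A" "j \<in> {1..card A}"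
  shows "nth_point (f ` A) j = f (nth_point A j)"
  unfolding nth_point_def sorted_list_of_set_image_strict_mono[OF assms(1,2)]
  by (rule nth_map) (use assms in auto)

text \<open>The increasing enumeration of the numbers other than \<open>i\<close>.\<close>

definition skip :: "nat \<Rightarrow> nat \<Rightarrow> nat" where
  "skip i j = (if j < i then j else Suc j)"

lemma strict_mono_skip: "strict_mono (skip i)"
  by (rule strict_monoI) (auto simp: skip_def)

lemma skip_image: "i \<in> {1..Suc n} \<Longrightarrow> skip i ` {1..n} = {1..Suc n} - {i}"
proof -
  assume i: "i \<in> {1..Suc n}"
  have "x \<in> skip i ` {1..n}" if "x \<in> {1..Suc n} - {i}" for x
    by (rule image_eqI[of _ _ "if x < i then x else x - 1"]) (use that i in \<open>auto simp: skip_def\<close>)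
  moreover have "skip i x \<in> {1..Suc n} - {i}" if "x \<in> {1..n}" for x
    using that i by (auto simp: skip_def)
  ultimately show ?thesis by (intro equalityI subsetI image_subsetI)
qed

text \<open>After removing the point at \<open>i\<close>, closing the gaps among positions and among
  values changes no comparison between the remaining points.\<close>

lemma delete_point:
  assumes \<pi>: "\<pi> permutes {1..Suc n}" and i: "i \<in> {1..Suc n}"
  shows "\<exists>\<pi>'. \<pi>' permutes {1..n} \<and>
    (\<forall>A\<subseteq>{1..n}. \<forall>\<sigma>. induces \<pi>' A \<sigma> \<longleftrightarrow> induces \<pi> (skip i ` A) \<sigma>)"
proof -
  \<comment> \<open>\<open>del\<close> closes the gap at the value \<open>\<pi> i\<close>; it is
    strictly increasing on all other values.\<close>
  define del where "del w = (if w < \<pi> i then w else w - 1)" for w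
  define \<pi>' where "\<pi>' j = (if j \<in> {1..n} then del (\<pi> (skip i j)) else j)" for j
  have ne: "\<pi> (skip i j) \<noteq> \<pi> i" for j
    using permutes_inj[OF \<pi>] by (auto simp: inj_eq skip_def)
  have range: "\<pi> (skip i j) \<in> {1..Suc n}" if "j \<in> {1..n}" for j
    using permutes_in_image[OF \<pi>] skip_image[OF i] that by blast
  have \<pi>i: "\<pi> i \<in> {1..Suc n}" using permutes_in_image[OF \<pi>] i by blast
  have less: "\<pi>' j < \<pi>' j' \<longleftrightarrow> \<pi> (skip i j) < \<pi> (skip i j')" if "j \<in> {1..n}" "j' \<in> {1..n}" for j j'
    using that ne[of j] ne[of j'] by (auto simp: \<pi>'_def del_def)
  have "inj_on \<pi>' {1..n}"
  proof (rule inj_onI)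
    fix j j' assume *: "j \<in> {1..n}" "j' \<in> {1..n}" "\<pi>' j = \<pi>' j'"
    hence "\<pi> (skip i j) = \<pi> (skip i j')" using less[of j j'] less[of j' j] by simp
    thus "j = j'" using permutes_inj[OF \<pi>] strict_mono_skip by (simp add: inj_eq strict_mono_eq)
  qed
  moreover have "\<pi>' ` {1..n} \<subseteq> {1..n}"
  proof
    fix v assume "v \<in> \<pi>' ` {1..n}"
    then obtain j where j: "j \<in> {1..n}" "v = \<pi>' j" by blast
    show "v \<in> {1..n}" using range[OF j(1)] ne[of j] \<pi>i j by (auto simp: \<pi>'_def del_def)
  qed
  ultimately have "bij_betw \<pi>' {1..n} {1..n}" by (simp add: bij_betw_def endo_inj_surj)
  hence "\<pi>' permutes {1..n}" by (rule bij_imp_permutes) (auto simp: \<pi>'_def)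
  moreover have "induces \<pi>' A \<sigma> \<longleftrightarrow> induces \<pi> (skip i ` A) \<sigma>" if A: "A \<subseteq> {1..n}" for A \<sigma>
  proof -
    have fin: "finite A" using A by (rule finite_subset) simp
    have card: "card (skip i ` A) = card A"
      using strict_mono_imp_inj_on[OF strict_mono_skip] by (intro card_image) (auto simp: inj_on_def)
    have "nth_point A j \<in> {1..n}" if "j \<in> {1..card A}" for j
      using nth_point_mem[OF fin that] A by blast
    thus ?thesis unfolding induces_def card
      using less nth_point_image[OF strict_mono_skip fin] by simp
  qed
  ultimately show ?thesis by blast
qed

definition max_density :: "nat \<Rightarrow> (nat \<Rightarrow> nat) \<Rightarrow> nat \<Rightarrow> real" where
  "max_density s \<sigma> n = Max {density s \<sigma> n \<pi> |\<pi>. \<pi> permutes {1..n}}"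

lemma finite_densities: "finite {density s \<sigma> n \<pi> |\<pi>. \<pi> permutes {1..n}}"
  using finite_permutations[of "{1..n}"] by (simp add: setcompr_eq_image)

lemma density_le_max_density: "\<pi> permutes {1..n} \<Longrightarrow> density s \<sigma> n \<pi> \<le> max_density s \<sigma> n"
  unfolding max_density_def by (rule Max_ge[OF finite_densities]) auto

lemma max_density_nonneg: "0 \<le> max_density s \<sigma> n"
  using density_le_max_density[OF permutes_id, of s \<sigma> n]
  by (rule order_trans[rotated]) (simp add: density_def)

text \<open>Averaging over the point that is deleted.\<close>
lemma density_Suc_le_max_density:
  assumes \<pi>: "\<pi> permutes {1..Suc n}" and s: "s \<le> n"
  shows "density s \<sigma> (Suc n) \<pi> \<le> max_density s \<sigma> n"
proof -
  let ?S = "{1..Suc n}" and ?C = "occurrences s \<sigma> (Suc n) \<pi>"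
  have fin: "finite ?C" by (rule finite_subset[of _ "Pow ?S"]) auto
  \<comment> \<open>The occurrences that avoid \<open>i\<close> survive its deletion, so they are
    bounded by the optimum for order \<open>n\<close>.\<close>
  have le: "real (card {A \<in> ?C. i \<notin> A}) \<le> max_density s \<sigma> n * real (n choose s)" if i: "i \<in> ?S" for i
  proof -
    obtain \<pi>' where \<pi>': "\<pi>' permutes {1..n}"
      "\<And>A \<sigma>. A \<subseteq> {1..n} \<Longrightarrow> induces \<pi>' A \<sigma> \<longleftrightarrow> induces \<pi> (skip i ` A) \<sigma>"
      using delete_point[OF \<pi> i] by blast
    have inj: "inj (skip i)" by (rule strict_mono_imp_inj_on[OF strict_mono_skip])
    have "{A \<in> ?C. i \<notin> A} \<subseteq> image (skip i) ` occurrences s \<sigma> n \<pi>'"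
    proof
      fix A assume A: "A \<in> {A \<in> ?C. i \<notin> A}"
      hence "A \<subseteq> skip i ` {1..n}" using skip_image[OF i] by auto
      then obtain B where B: "B \<subseteq> {1..n}" "A = skip i ` B" by (auto simp: subset_image_iff)
      moreover have "card A = card B" unfolding B(2) by (rule card_image[OF inj_on_subset[OF inj]]) simp
      ultimately have "B \<in> occurrences s \<sigma> n \<pi>'" using A \<pi>'(2)[OF B(1)] by auto
      thus "A \<in> image (skip i) ` occurrences s \<sigma> n \<pi>'" using B(2) by blast
    qed
    moreover have fin': "finite (occurrences s \<sigma> n \<pi>')"
      by (rule finite_subset[of _ "Pow {1..n}"]) auto
    ultimately have "card {A \<in> ?C. i \<notin> A} \<le> card (occurrences s \<sigma> n \<pi>')"
      using surj_card_le[of "occurrences s \<sigma> n \<pi>'"] by blast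
    moreover have "real (card (occurrences s \<sigma> n \<pi>')) = density s \<sigma> n \<pi>' * real (n choose s)"
      unfolding density_eq using s by simp
    ultimately show ?thesis
      using mult_right_mono[OF density_le_max_density[OF \<pi>'(1), of s \<sigma>], of "real (n choose s)"]
      by linarith
  qed
  \<comment> \<open>Double counting: an occurrence survives the deletion of exactly the
    \<open>Suc n - s\<close> points outside it.\<close>
  have "(\<Sum>i\<in>?S. card {A \<in> ?C. i \<notin> A}) = (\<Sum>A\<in>?C. Suc n - s)"
  proof (rule sum_multicount_gen)
    show "\<forall>A\<in>?C. card {i \<in> ?S. i \<notin> A} = Suc n - s"
    proof
      fix A assume A: "A \<in> ?C"
      hence "finite A" using finite_subset[of A ?S] by simp
      moreover have "{i \<in> ?S. i \<notin> A} = ?S - A" by auto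
      ultimately show "card {i \<in> ?S. i \<notin> A} = Suc n - s" using A by (simp add: card_Diff_subset)
    qed
  qed (use fin in auto)
  hence "real (card ?C) * real (Suc n - s) = (\<Sum>i\<in>?S. real (card {A \<in> ?C. i \<notin> A}))"
    by (simp flip: of_nat_sum of_nat_mult)
  also have "\<dots> \<le> (\<Sum>i\<in>?S. max_density s \<sigma> n * real (n choose s))"
    by (rule sum_mono) (rule le)
  also have "\<dots> = max_density s \<sigma> n * real (Suc n * (n choose s))" by (simp add: algebra_simps)
  also have "Suc n * (n choose s) = (Suc n choose s) * (Suc n - s)"
    using binomial_absorb_comp[of "Suc n" s] by (simp add: mult.commute)
  finally have "real (card ?C) \<le> max_density s \<sigma> n * real (Suc n choose s)"
    using s by (simp add: mult.assoc[symmetric] del: binomial_Suc_Suc)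
  thus ?thesis unfolding density_eq using s
    by (simp add: divide_le_eq del: binomial_Suc_Suc)
qed

text \<open>\<open>lim\<close> is meaningful only for a convergent sequence. This one is nonnegative
  and, by averaging, decreasing from order \<open>s\<close> on, hence the shift by
  \<open>s\<close>.\<close>

lemma max_density_tendsto: "max_density s \<sigma> \<longlonglongrightarrow> packing_density s \<sigma>"
proof -
  have "max_density s \<sigma> (Suc n) \<le> max_density s \<sigma> n" if "s \<le> n" for n
    unfolding max_density_def[of _ _ "Suc n"]
    using finite_densities[of s \<sigma> "Suc n"] density_Suc_le_max_density[OF _ that]
    by (subst Max_le_iff) (auto intro: permutes_id)
  hence "decseq (\<lambda>n. max_density s \<sigma> (n + s))" by (intro decseq_SucI) simp
  then obtain L where "(\<lambda>n. max_density s \<sigma> (n + s)) \<longlonglongrightarrow> L"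
    using decseq_convergent[of _ 0] max_density_nonneg by metis
  hence "max_density s \<sigma> \<longlonglongrightarrow> L" by (rule LIMSEQ_offset)
  hence "convergent (max_density s \<sigma>)" by (rule convergentI)
  thus ?thesis unfolding convergent_LIMSEQ_iff packing_density_def max_density_def .
qed

section \<open>Asymptotics and compactness\<close>

abbreviation prod_fact :: "nat list \<Rightarrow> real" where
  "prod_fact es \<equiv> prod_list (map fact es)"

lemma prod_fact_pos: "0 < prod_fact es"
  by (induction es) auto

section \<open>Limits of densities and matching bounds\<close>

lemma tendsto_binomial_div_power:
  fixes b :: "nat \<Rightarrow> nat"
  assumes "(\<lambda>N. real (b N) / real N) \<longlonglongrightarrow> y"
  shows "(\<lambda>N. real (b N choose e) / real N ^ e) \<longlonglongrightarrow> y ^ e / fact e"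
proof (induction e)
  case (Suc e)
  have "(\<lambda>N. real e / real N) \<longlonglongrightarrow> 0" by (rule lim_const_over_n)
  from tendsto_diff[OF assms this]
  have "(\<lambda>N. real (b N choose e) / real N ^ e * (real (b N) / real N - real e / real N) / real (Suc e))
      \<longlonglongrightarrow> y ^ e / fact e * (y - 0) / real (Suc e)"
    by (intro tendsto_mult tendsto_divide tendsto_const Suc) auto
  moreover have "real (b N choose e) / real N ^ e * (real (b N) / real N - real e / real N) / real (Suc e)
      = real (b N choose Suc e) / real N ^ Suc e" for N
  \<comment> \<open>The recursion is used over the reals, where \<open>real (b N) - real e\<close>
    is not truncated at zero.\<close>
  proof -
    have "real (b N choose Suc e) * real (Suc e) = real (b N choose e) * (real (b N) - real e)"
      using gbinomial_mult_1[of "real (b N)" e] by (simp add: binomial_gbinomial algebra_simps)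
    hence "real (b N choose Suc e) = real (b N choose e) * (real (b N) - real e) / real (Suc e)"
      by (simp add: field_simps del: of_nat_Suc)
    thus ?thesis by (simp add: diff_divide_distrib[symmetric])
  qed
  ultimately show ?case by (simp add: mult.commute)
qed simp

lemma tendsto_power_div_binomial: "(\<lambda>N. real N ^ s / real (N choose s)) \<longlonglongrightarrow> fact s"
proof -
  have "\<forall>\<^sub>F N in sequentially. real N / real N = 1"
    using eventually_gt_at_top[of 0] by eventually_elim simp
  hence "(\<lambda>N. real N / real N) \<longlonglongrightarrow> 1" by (rule tendsto_eventually)
  from tendsto_inverse[OF tendsto_binomial_div_power[OF this, of s]]
  show ?thesis by simp
qed

lemma tendsto_layer_sum_choose:
  assumes "\<And>y. y \<in> set ys \<Longrightarrow> (\<lambda>N. real (b y N) / real N) \<longlonglongrightarrow> y"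
  shows "(\<lambda>N. real (layer_sum (choose) es (map (\<lambda>y. b y N) ys)) / real N ^ sum_list es)
    \<longlonglongrightarrow> layer_poly es ys / prod_fact es"
  using assms
proof (induction ys arbitrary: es)
  case Nil
  show ?case by (cases es) auto
next
  case (Cons y ys)
  show ?case
  proof (cases es)
    case (Cons e es')
    have "(\<lambda>N. real (b y N choose e) / real N ^ e *
          (real (layer_sum (choose) es' (map (\<lambda>y. b y N) ys)) / real N ^ sum_list es') +
          real (layer_sum (choose) es (map (\<lambda>y. b y N) ys)) / real N ^ sum_list es)
        \<longlonglongrightarrow> y ^ e / fact e * (layer_poly es' ys / prod_fact es') + layer_poly es ys / prod_fact es"
      using Cons.prems by (intro tendsto_intros tendsto_binomial_div_power Cons.IH) auto
    thus ?thesis by (simp add: Cons power_add add_divide_distrib)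
  qed simp
qed

lemma layer_sum_choose_append_le:
  "layer_sum (choose) es bs \<le> layer_sum (choose) es (bs @ cs)"
  by (induction "(choose)" es bs rule: layer_sum.induct) (auto intro: add_mono mult_le_mono2)

text \<open>Layered permutations whose layer sizes are rounded multiples of \<open>ys\<close> reach
  the left side in the limit, and their densities are bounded by \<open>max_density\<close>.\<close>

lemma density_pattern_le_packing_density:
  assumes \<sigma>: "has_layers s \<sigma> es" and ys: "weights ys"
  shows "fact s / prod_fact es * layer_poly es ys \<le> packing_density s \<sigma>"
proof -
  \<comment> \<open>Rounding down keeps the total at most \<open>N\<close>. The remainder becomes
    one more layer, which cannot destroy copies, and empty layers are filtered out.\<close>
  define b where "b y N = nat \<lfloor>y * real N\<rfloor>" for y :: real and N :: nat
  define cs where "cs N = map (\<lambda>y. b y N) ys" for N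
  define bs where "bs N = filter (\<lambda>c. c \<noteq> 0) (cs N @ [N - sum_list (cs N)])" for N
  have s: "s = sum_list es" and es: "\<forall>e\<in>set es. 0 < e" using has_layersD[OF \<sigma>] by auto
  have nn: "\<forall>y\<in>set ys. 0 \<le> y" and sum1: "sum_list ys = 1" using ys by (auto simp: weights_def)
  have le: "sum_list (cs N) \<le> N" for N
  proof -
    have "real (sum_list (map (\<lambda>y. b y N) zs)) \<le> sum_list zs * real N" if "\<forall>y\<in>set zs. 0 \<le> y" for zs
      using that
    proof (induction zs)
      case (Cons z zs)
      have "real (b z N) \<le> z * real N" unfolding b_def using Cons.prems by simp
      thus ?case using Cons by (simp add: algebra_simps)
    qed simp
    from this[OF nn] show ?thesis using sum1 by (simp add: cs_def)
  qed
  have lim: "(\<lambda>N. real (b y N) / real N) \<longlonglongrightarrow> y" if "y \<in> set ys" for y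
  proof (rule tendsto_sandwich)
    have "(\<lambda>N. y - 1 / real N) \<longlonglongrightarrow> y - 0" by (intro tendsto_intros lim_const_over_n)
    thus "(\<lambda>N. y - 1 / real N) \<longlonglongrightarrow> y" by simp
    have "y - 1 / real N \<le> real (b y N) / real N \<and> real (b y N) / real N \<le> y" if "0 < N" for N
    proof -
      have "0 \<le> y * real N" using nn \<open>y \<in> set ys\<close> by simp
      hence "real (b y N) = of_int \<lfloor>y * real N\<rfloor>" unfolding b_def by simp
      hence "y * real N - 1 \<le> real (b y N)" "real (b y N) \<le> y * real N" by linarith+
      hence "(y * real N - 1) / real N \<le> real (b y N) / real N"
        "real (b y N) / real N \<le> y * real N / real N"
        by - (rule divide_right_mono, assumption, simp)+
      thus ?thesis using that by (simp add: diff_divide_distrib)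
    qed
    thus "\<forall>\<^sub>F N in sequentially. y - 1 / real N \<le> real (b y N) / real N"
      "\<forall>\<^sub>F N in sequentially. real (b y N) / real N \<le> y"
      by (auto intro: eventually_mono[OF eventually_gt_at_top[of 0]])
  qed simp
  \<comment> \<open>The factor \<open>real N ^ s\<close> is inserted so that both quotients
    converge.\<close>
  have ge: "real (layer_sum (choose) es (cs N)) / real N ^ s * (real N ^ s / real (N choose s))
      \<le> max_density s \<sigma> N" if "0 < N" for N
  proof -
    have "sum_list (bs N) = sum_list (cs N @ [N - sum_list (cs N)])"
      unfolding bs_def by (rule sum_list_filter_nonzero)
    hence "sum_list (bs N) = N" using le[of N] by simp
    moreover have "\<forall>c\<in>set (bs N). 0 < c" unfolding bs_def by auto
    ultimately obtain \<pi> where \<pi>: "has_layers N \<pi> (bs N)" using ex_has_layers by metis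
    have "layer_sum (choose) es (cs N) \<le> layer_sum (choose) es (cs N @ [N - sum_list (cs N)])"
      by (rule layer_sum_choose_append_le)
    also have "\<dots> = layer_sum (choose) es (bs N)"
      unfolding bs_def by (rule layer_sum_filter[symmetric]) (use es in auto)
    finally have "real (layer_sum (choose) es (cs N)) / real (N choose s) \<le> density s \<sigma> N \<pi>"
      unfolding density_layered[OF \<pi> \<sigma>] by (intro divide_right_mono) auto
    also have "\<dots> \<le> max_density s \<sigma> N"
      by (rule density_le_max_density) (use \<pi> in \<open>simp add: has_layers_def\<close>)
    finally show ?thesis using that by simp
  qed
  have "layer_poly es ys / prod_fact es * fact s \<le> packing_density s \<sigma>"
  proof (rule tendsto_le[OF _ max_density_tendsto])
    show "(\<lambda>N. real (layer_sum (choose) es (cs N)) / real N ^ s * (real N ^ s / real (N choose s)))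
        \<longlonglongrightarrow> layer_poly es ys / prod_fact es * fact s"
      unfolding cs_def s by (intro tendsto_mult tendsto_layer_sum_choose tendsto_power_div_binomial lim)
    show "\<forall>\<^sub>F N in sequentially. real (layer_sum (choose) es (cs N)) / real N ^ s *
        (real N ^ s / real (N choose s)) \<le> max_density s \<sigma> N"
      using eventually_gt_at_top[of 0] by eventually_elim (rule ge)
  qed simp
  thus ?thesis by (simp add: mult.commute)
qed

text \<open>Termwise \<open>(b choose e) * fact e \<le> b ^ e\<close>. An inequality for each list
  is wanted here because the layer sizes in a given sequence need not converge after
  scaling.\<close>

lemma layer_sum_choose_le:
  "real (layer_sum (choose) es bs) * prod_fact es \<le> layer_poly es (map real bs)"
proof (induction bs arbitrary: es)
  case Nil
  show ?case by (cases es) auto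
next
  case (Cons b bs)
  show ?case
  proof (cases es)
    case es: (Cons e es')
    have "real (b choose e) * fact e = real ((b choose e) * fact e)" by simp
    also have "\<dots> \<le> real (b ^ e)" using binomial_fact_pow by (rule of_nat_mono)
    finally have "real (b choose e) * fact e \<le> real b ^ e" by simp
    hence "(real (b choose e) * fact e) * (real (layer_sum (choose) es' bs) * prod_fact es')
        \<le> real b ^ e * layer_poly es' (map real bs)"
      using prod_fact_pos[of es'] by (intro mult_mono Cons.IH) auto
    thus ?thesis using Cons.IH[of es] by (simp add: es algebra_simps)
  qed simp
qed

lemma layer_poly_scale:
  "layer_poly es (map (\<lambda>b. b * c) xs) = layer_poly es xs * c ^ sum_list es"
  by (induction "power :: real \<Rightarrow> nat \<Rightarrow> real" es xs rule: layer_sum.induct)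
    (auto simp: power_mult_distrib power_add algebra_simps)

text \<open>The counterpart of the lower bound on the packing density: the factor in front tends to
  \<open>fact s\<close>.\<close>

lemma density_layered_le:
  assumes \<pi>: "has_layers N \<pi> bs" and \<sigma>: "has_layers s \<sigma> es" and N: "0 < N"
  shows "density s \<sigma> N \<pi> \<le> real N ^ s / real (N choose s) *
    (layer_poly es (map (\<lambda>b. real b / real N) bs) / prod_fact es)"
proof -
  have "layer_poly es (map (\<lambda>b. real b / real N) bs) * real N ^ s = layer_poly es (map real bs)"
    using layer_poly_scale[of es "1 / real N" "map real bs"] has_layersD(1)[OF \<sigma>] N
    by (simp add: o_def power_divide)
  moreover have "real (layer_sum (choose) es bs) \<le> layer_poly es (map real bs) / prod_fact es"
    using layer_sum_choose_le[of es bs] prod_fact_pos[of es] by (simp add: field_simps)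
  ultimately have "real (layer_sum (choose) es bs)
      \<le> real N ^ s * (layer_poly es (map (\<lambda>b. real b / real N) bs) / prod_fact es)"
    by (simp add: mult.commute)
  from divide_right_mono[OF this, of "real (N choose s)"] show ?thesis
    unfolding density_layered[OF \<pi> \<sigma>] by (simp add: mult.commute)
qed

section \<open>Compactness of bounded weight vectors\<close>

lemma continuous_on_layer_poly:
  "continuous_on S (\<lambda>x :: nat \<Rightarrow> real. layer_poly es (map x is))"
proof (induction "is" arbitrary: es)
  case (Cons i "is")
  have "continuous_on S (\<lambda>x :: nat \<Rightarrow> real. x i)"
    by (rule continuous_on_subset[OF continuous_on_product_coordinates]) simp
  thus ?case using Cons by (cases es) (auto intro!: continuous_intros)
qed (cases es; simp)

lemma layer_poly_append_zeros:
  assumes "\<forall>e\<in>set es. 0 < e"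
  shows "layer_poly es (xs @ replicate m 0) = layer_poly es xs"
proof -
  have "layer_poly es (filter (\<lambda>x. x \<noteq> 0) zs) = layer_poly es zs" for zs
    by (rule layer_sum_filter) (use assms in auto)
  from this[of xs] this[of "xs @ replicate m 0"] show ?thesis by simp
qed

text \<open>Padding with zeros brings all these vectors to length \<open>L\<close> without changing
  their value, and the polynomial is continuous on a compact set.\<close>

lemma layer_poly_attains_sup:
  assumes es: "\<forall>e\<in>set es. 0 < e" and L: "0 < L"
  shows "\<exists>xs. weights xs \<and>
    (\<forall>zs. weights zs \<and> length zs \<le> L \<longrightarrow> layer_poly es zs \<le> layer_poly es xs)"
proof -
  \<comment> \<open>Vectors are encoded as functions on all of \<open>nat\<close>, so that Tychonoff
    gives compactness of the cube; coordinates from \<open>L\<close> on are free and ignored by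
    \<open>?f\<close>.\<close>
  define K where "K = {x :: nat \<Rightarrow> real. (\<forall>i. x i \<in> {0..1}) \<and> (\<Sum>i<L. x i) = 1}"
  let ?f = "\<lambda>x. layer_poly es (map x [0..<L])"
  have "compactin (product_topology (\<lambda>i. euclidean) UNIV) (PiE UNIV (\<lambda>i :: nat. {0..1 :: real}))"
    by (subst compactin_PiE) simp
  hence "compact {x :: nat \<Rightarrow> real. \<forall>i. x i \<in> {0..1}}"
    by (simp add: euclidean_product_topology PiE_UNIV_domain Pi_def)
  moreover have "closed {x :: nat \<Rightarrow> real. (\<Sum>i<L. x i) = 1}"
    by (intro closed_Collect_eq continuous_intros continuous_on_product_coordinates)
  ultimately have "compact K"
    unfolding K_def Collect_conj_eq by (rule compact_Int_closed)
  moreover have mem: "(\<lambda>i. if i < L then (zs @ replicate (L - length zs) 0) ! i else 0) \<in> K"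
    (is "?x zs \<in> K") if "weights zs" "length zs \<le> L" for zs
  proof -
    let ?zs = "zs @ replicate (L - length zs) 0"
    have len: "length ?zs = L" using that by simp
    have nn: "\<forall>z\<in>set ?zs. 0 \<le> z" and sum: "sum_list ?zs = 1"
      using that by (auto simp: weights_def sum_list_replicate)
    have "?x zs i \<in> {0..1}" for i
    proof (cases "i < L")
      case True
      hence "?zs ! i \<in> set ?zs" using len by (metis nth_mem)
      thus ?thesis using True nn sum member_le_sum_list[of "?zs ! i" ?zs] by auto
    qed simp
    moreover have "(\<Sum>i<L. ?x zs i) = 1"
      using sum len by (simp add: sum_list_sum_nth atLeast0LessThan)
    ultimately show ?thesis unfolding K_def by simp
  qed
  have "weights [1]" by (simp add: weights_def)
  hence "K \<noteq> {}" using mem[of "[1]"] L by auto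
  ultimately obtain x where x: "x \<in> K" "\<And>y. y \<in> K \<Longrightarrow> ?f y \<le> ?f x"
    using continuous_attains_sup[OF _ _ continuous_on_layer_poly, of K es "[0..<L]"] by blast
  have "weights (map x [0..<L])"
    using x(1) by (auto simp: K_def weights_def interv_sum_list_conv_sum_set_nat atLeast0LessThan)
  moreover have "layer_poly es zs \<le> ?f x" if zs: "weights zs" "length zs \<le> L" for zs
  proof -
    have "map (?x zs) [0..<L] = zs @ replicate (L - length zs) 0"
      using zs by (intro nth_equalityI) auto
    thus ?thesis using x(2)[OF mem[OF zs]] layer_poly_append_zeros[OF es] by simp
  qed
  ultimately show ?thesis by blast
qed

section \<open>Few layers keep the density away from the optimum\<close>

theorem theorem1p4:
  fixes k :: nat and ls :: "nat list"
  assumes "length ls = k" and "\<forall>l\<in>set ls. 0 < l"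
  shows "\<exists>n0. \<forall>n\<ge>n0. \<forall>\<sigma>. has_layers (sum_list (n # 1 # ls)) \<sigma> (n # 1 # ls) \<longrightarrow>
           (\<forall>N \<pi>. near_optimal (sum_list (n # 1 # ls)) \<sigma> N \<pi> \<and> (\<forall>m. layered (N m) (\<pi> m)) \<longrightarrow>
              filterlim (\<lambda>m. num_layers (N m) (\<pi> m)) at_top sequentially)"
proof -
  obtain n0 where n0: "\<And>n xs. n0 \<le> n \<Longrightarrow> weights xs \<Longrightarrow>
      \<exists>ys. weights ys \<and> layer_poly (n # 1 # ls) xs < layer_poly (n # 1 # ls) ys"
    using layer_poly_improvable[OF assms(2)] unfolding eventually_sequentially by blast
  have "filterlim (\<lambda>m. num_layers (N m) (\<pi> m)) at_top sequentially"
    if n: "n0 \<le> n" and \<sigma>: "has_layers s \<sigma> (n # 1 # ls)"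
      and opt: "near_optimal s \<sigma> N \<pi>" and lay: "\<And>m. layered (N m) (\<pi> m)" for n s \<sigma> N \<pi>
    unfolding filterlim_at_top
  proof
    fix L
    let ?es = "n # 1 # ls"
    define c where "c = prod_fact ?es"
    have c: "0 < c" unfolding c_def by (rule prod_fact_pos)
    \<comment> \<open>\<open>Suc L\<close> in place of \<open>L\<close> keeps the length bound
      positive when \<open>L\<close> is \<open>0\<close>.\<close>
    obtain xs where xs: "weights xs"
      "\<And>zs. weights zs \<Longrightarrow> length zs \<le> Suc L \<Longrightarrow> layer_poly ?es zs \<le> layer_poly ?es xs"
      using layer_poly_attains_sup[of ?es "Suc L"] has_layersD(2)[OF \<sigma>] by blast
    obtain ys where ys: "weights ys" "layer_poly ?es xs < layer_poly ?es ys"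
      using n0[OF n xs(1)] by blast
    \<comment> \<open>Up to the factor \<open>real N ^ s / real (N choose s)\<close>,
      \<open>h\<close> bounds the density for at most \<open>Suc L\<close> layers; the improvement
      \<open>ys\<close> puts the packing density strictly above \<open>fact s * h\<close>.\<close>
    define h where "h = layer_poly ?es xs / c"
    have "fact s * h < fact s / c * layer_poly ?es ys"
      using ys(2) c by (simp add: h_def field_simps)
    also have "\<dots> \<le> packing_density s \<sigma>"
      unfolding c_def by (rule density_pattern_le_packing_density[OF \<sigma> ys(1)])
    finally have gap: "0 < packing_density s \<sigma> - fact s * h" by simp
    have N: "filterlim N at_top sequentially"
      and dens: "(\<lambda>m. density s \<sigma> (N m) (\<pi> m)) \<longlonglongrightarrow> packing_density s \<sigma>"
      using opt unfolding near_optimal_def by auto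
    \<comment> \<open>The limit is the positive gap, so eventually the density exceeds the bound for
      few layers.\<close>
    have "(\<lambda>m. density s \<sigma> (N m) (\<pi> m) - real (N m) ^ s / real (N m choose s) * h)
        \<longlonglongrightarrow> packing_density s \<sigma> - fact s * h"
      by (intro tendsto_intros dens filterlim_compose[OF tendsto_power_div_binomial N])
    hence "\<forall>\<^sub>F m in sequentially.
        0 < density s \<sigma> (N m) (\<pi> m) - real (N m) ^ s / real (N m choose s) * h"
      using gap by (rule order_tendstoD(1))
    moreover have "\<forall>\<^sub>F m in sequentially. 0 < N m"
      using N eventually_compose_filterlim[OF eventually_gt_at_top[of 0]] by blast
    ultimately show "\<forall>\<^sub>F m in sequentially. L \<le> num_layers (N m) (\<pi> m)"
    proof eventually_elim
      case (elim m)
      obtain bs where bs: "has_layers (N m) (\<pi> m) bs" using lay unfolding layered_def by blast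
      let ?zs = "map (\<lambda>b. real b / real (N m)) bs"
      show ?case
      proof (rule ccontr)
        assume "\<not> L \<le> num_layers (N m) (\<pi> m)"
        hence "length ?zs \<le> Suc L" using num_layers_eq[OF bs] by simp
        moreover have "weights ?zs"
        proof -
          have "sum_list ?zs = real (sum_list bs) / real (N m)"
            by (induction bs) (auto simp: add_divide_distrib)
          thus ?thesis using has_layersD(1)[OF bs] elim(2) by (auto simp: weights_def)
        qed
        ultimately have "layer_poly ?es ?zs / c \<le> h"
          unfolding h_def using xs(2) c by (intro divide_right_mono) auto
        hence "real (N m) ^ s / real (N m choose s) * (layer_poly ?es ?zs / c)
            \<le> real (N m) ^ s / real (N m choose s) * h"
          by (rule mult_left_mono) simp
        thus False using density_layered_le[OF bs \<sigma> elim(2)] elim(1) unfolding c_def by linarith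
      qed
    qed
  qed
  thus ?thesis by blast
qed

end
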